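(* The chromatic symmetric function distinguishes cuttlefish from among all connected unicyclic graphs on $n$ vertices: if $C$ is a cuttlefish on $n$ vertices and $G$ is a connected unicyclic graph on $n$ vertices with $\mathbf{X}_G=\mathbf{X}_C$, then $G\cong C$.
   Context: All graphs are finite and simple. The chromatic symmetric function of a graph $G$ with vertices $v_1,\dots,v_n$ is $\mathbf{X}_G=\sum_\kappa x_{\kappa(v_1)}\cdots x_{\kappa(v_n)}$, summed over all proper colorings $\kappa:V(G)\to\mathbb{N}$. A unicyclic graph is a graph containing exactly one cycle. A squid is a connected unicyclic graph with exactly one vertex of degree greater than $2$; equivalently, a cycle together with some number of paths (tentacles) emanating from a single cycle vertex. A cuttlefish is a squid all of whose tentacles have length $1$, i.e. a graph obtained from a cycle by attaching some number of leaves to a single vertex of the cycle. *)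

theory Defs
  imports
    "Graph_Theory.Graph_Theory"
    "HOL-Library.FuncSet"
    "HOL-Library.Poly_Mapping"
begin

text \<open>
  Finite simple graphs are the graphs of the locale \<^locale>\<open>pair_graph\<close>: finite, loopfree and
  symmetric, so that an edge \<open>{u, v}\<close> is represented by the two arcs \<open>(u, v)\<close> and \<open>(v, u)\<close>.
  In particular the degree of a vertex is its out-degree.
\<close>

definition proper_colorings :: "'a pair_pre_digraph \<Rightarrow> ('a \<Rightarrow> nat) set" where
  "proper_colorings G =
    {\<kappa> \<in> pverts G \<rightarrow>\<^sub>E UNIV. \<forall>(u, v) \<in> parcs G. \<kappa> u \<noteq> \<kappa> v}"

text \<open>
  A monomial in the variables \<open>x\<^sub>0, x\<^sub>1, \<dots>\<close> is given by its finitely supported exponent function, so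
  the product of the variables \<open>x\<^bsub>\<kappa> v\<^esub>\<close> becomes a sum of exponents.
\<close>

definition coloring_monomial :: "'a pair_pre_digraph \<Rightarrow> ('a \<Rightarrow> nat) \<Rightarrow> (nat \<Rightarrow>\<^sub>0 nat)" where
  "coloring_monomial G \<kappa> = (\<Sum>v\<in>pverts G. Poly_Mapping.single (\<kappa> v) 1)"

text \<open>
  A formal power series in \<open>x\<^sub>0, x\<^sub>1, \<dots>\<close> is the function sending each monomial to its coefficient.
  The coefficient of \<open>m\<close> in the formal sum of the monomials of all proper colorings is the number
  of proper colorings with monomial \<open>m\<close>, which is finite by \<open>finite_colorings_of_monomial\<close> below.
\<close>

definition chromatic_symmetric_function :: "'a pair_pre_digraph \<Rightarrow> (nat \<Rightarrow>\<^sub>0 nat) \<Rightarrow> int" where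
  "chromatic_symmetric_function G m =
    int (card {\<kappa> \<in> proper_colorings G. coloring_monomial G \<kappa> = m})"

lemma finite_colorings_of_monomial:
  assumes "finite (pverts G)"
  shows "finite {\<kappa> \<in> proper_colorings G. coloring_monomial G \<kappa> = m}"
proof (rule finite_subset)
  show "finite (pverts G \<rightarrow>\<^sub>E Poly_Mapping.keys m)"
    using assms by (intro finite_PiE) auto
  show "{\<kappa> \<in> proper_colorings G. coloring_monomial G \<kappa> = m} \<subseteq> pverts G \<rightarrow>\<^sub>E Poly_Mapping.keys m"
  proof
    fix \<kappa> assume k: "\<kappa> \<in> {\<kappa> \<in> proper_colorings G. coloring_monomial G \<kappa> = m}"
    have "\<kappa> v \<in> Poly_Mapping.keys m" if "v \<in> pverts G" for v
    proof -
      have "Poly_Mapping.lookup m (\<kappa> v) =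
          (\<Sum>w\<in>pverts G. Poly_Mapping.lookup (Poly_Mapping.single (\<kappa> w) 1) (\<kappa> v))"
        using k by (auto simp: coloring_monomial_def lookup_sum)
      also have "\<dots> \<ge> Poly_Mapping.lookup (Poly_Mapping.single (\<kappa> v) (1::nat)) (\<kappa> v)"
        using that assms by (intro member_le_sum) auto
      finally show ?thesis by (simp add: in_keys_iff)
    qed
    then show "\<kappa> \<in> pverts G \<rightarrow>\<^sub>E Poly_Mapping.keys m"
      using k by (auto simp: proper_colorings_def PiE_def)
  qed
qed

text \<open>
  The cycles contained in a graph, as subgraphs, given by their sets of undirected edges; passing to
  edge sets identifies the closed walks that differ only in base point or direction.
  The bound on the length excludes going back and forth along one edge, which is a cycle of the
  symmetric digraph.
\<close>

definition cycle_subgraphs :: "'a pair_pre_digraph \<Rightarrow> 'a set set set" where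
  "cycle_subgraphs G =
    {(\<lambda>(u, v). {u, v}) ` set p | p. pre_digraph.cycle (with_proj G) p \<and> 3 \<le> length p}"

definition unicyclic :: "'a pair_pre_digraph \<Rightarrow> bool" where
  "unicyclic G \<longleftrightarrow> (\<exists>!E. E \<in> cycle_subgraphs G)"

definition cycle_verts :: "'a pair_pre_digraph \<Rightarrow> 'a set" where
  "cycle_verts G = \<Union>(\<Union>(cycle_subgraphs G))"

definition squid :: "'a pair_pre_digraph \<Rightarrow> bool" where
  "squid G \<longleftrightarrow> Digraph_Component.connected (with_proj G) \<and> unicyclic G \<and>
    (\<exists>!v. v \<in> pverts G \<and> out_degree (with_proj G) v > 2)"

text \<open>
  A tentacle is a path that starts on the cycle, leaves it immediately for good and ends in a leaf.
  In a squid its first vertex is the vertex of degree greater than \<open>2\<close>.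
\<close>

definition tentacle :: "'a pair_pre_digraph \<Rightarrow> ('a \<times> 'a) list \<Rightarrow> bool" where
  "tentacle G p \<longleftrightarrow> p \<noteq> [] \<and>
    (\<exists>u v. pre_digraph.apath (with_proj G) u p v \<and> u \<in> cycle_verts G \<and>
       set (tl (pre_digraph.awalk_verts (with_proj G) u p)) \<inter> cycle_verts G = {} \<and>
       out_degree (with_proj G) v = 1)"

definition cuttlefish :: "'a pair_pre_digraph \<Rightarrow> bool" where
  "cuttlefish G \<longleftrightarrow> squid G \<and> (\<forall>p. tentacle G p \<longrightarrow> length p = 1)"

end

theory Submission
  imports Defs "HOL-Number_Theory.Cong"
begin

text \<open>
  Build a connected unicyclic graph \<open>G\<close> on \<open>n\<close> vertices from its cycle of length \<open>g\<close> by attaching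
  the remaining vertices one at a time, each to a single earlier vertex. Then the number of proper
  \<open>3\<close>-colorings is \<open>2\<^sup>n + (- 1)\<^sup>g 2\<^bsup>n - g + 1\<^esup>\<close>, which determines \<open>g\<close>. Let the excess of a vertex be
  its degree minus \<open>2\<close> on the cycle and its degree minus \<open>1\<close> off the cycle; the excesses add up to
  \<open>n - g\<close>. The proper \<open>3\<close>-colorings that use the last color exactly once are the proper
  \<open>2\<close>-colorings of the graphs \<open>G - v\<close>, and their number is twice the sum of \<open>2\<^bsup>excess v\<^esup>\<close> over all
  vertices \<open>v\<close>, or over the cycle vertices only if \<open>g\<close> is odd. By convexity, this sum is as large as
  for a cuttlefish only if a single vertex carries the whole excess. That vertex has to lie on the
  cycle, so \<open>G\<close> is a cuttlefish too.
\<close>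

section \<open>Colorings of a symmetric relation\<close>

definition nbrs :: "('a \<Rightarrow> 'a \<Rightarrow> bool) \<Rightarrow> 'a set \<Rightarrow> 'a \<Rightarrow> 'a set" where
  "nbrs adj S v = {w \<in> S. adj v w}"

text \<open>Relative to a vertex set, so that growing a graph and deleting a vertex only change
  \<open>S\<close> while \<open>adj\<close> stays fixed.\<close>

definition colorings :: "('a \<Rightarrow> 'a \<Rightarrow> bool) \<Rightarrow> nat \<Rightarrow> 'a set \<Rightarrow> ('a \<Rightarrow> nat) set" where
  "colorings adj k S = {\<kappa> \<in> S \<rightarrow>\<^sub>E {..<k}. \<forall>u\<in>S. \<forall>v\<in>S. adj u v \<longrightarrow> \<kappa> u \<noteq> \<kappa> v}"

lemma finite_colorings: "finite S \<Longrightarrow> finite (colorings adj k S)"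
  unfolding colorings_def by (rule finite_subset[of _ "S \<rightarrow>\<^sub>E {..<k}"]) (auto intro: finite_PiE)

lemma finite_nbrs [simp]: "finite S \<Longrightarrow> finite (nbrs adj S v)"
  by (simp add: nbrs_def)

locale adjacency =
  fixes adj :: "'a \<Rightarrow> 'a \<Rightarrow> bool"
  assumes adj_sym: "adj u v \<Longrightarrow> adj v u"
    and adj_irrefl: "\<not> adj v v"
begin

text \<open>A coloring of \<open>S\<close> extends to \<open>v\<close> by exactly the colors that no
  neighbor of \<open>v\<close> carries. The weight \<open>h\<close> is arbitrary because the cycle
  recursion has to record whether two end colors agree, not only to count.\<close>

lemma sum_colorings_insert:
  fixes h :: "('a \<Rightarrow> nat) \<Rightarrow> 'b::comm_monoid_add"
  assumes "finite S" "v \<notin> S"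
  shows "(\<Sum>\<kappa>\<in>colorings adj k (insert v S). h \<kappa>) =
    (\<Sum>\<kappa>\<in>colorings adj k S. \<Sum>c\<in>{..<k} - \<kappa> ` nbrs adj S v. h (\<kappa>(v := c)))"
proof -
  have "(\<Sum>\<kappa>\<in>colorings adj k S. \<Sum>c\<in>{..<k} - \<kappa> ` nbrs adj S v. h (\<kappa>(v := c))) =
    (\<Sum>(\<kappa>, c)\<in>Sigma (colorings adj k S) (\<lambda>\<kappa>. {..<k} - \<kappa> ` nbrs adj S v). h (\<kappa>(v := c)))"
    using assms by (intro sum.Sigma) (auto simp: finite_colorings)
  also have "\<dots> = (\<Sum>\<kappa>\<in>colorings adj k (insert v S). h \<kappa>)"
  proof (rule sum.reindex_bij_witness[of _ "\<lambda>\<kappa>. (restrict \<kappa> S, \<kappa> v)" "\<lambda>(\<kappa>, c). \<kappa>(v := c)"])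
    fix a assume a: "a \<in> Sigma (colorings adj k S) (\<lambda>\<kappa>. {..<k} - \<kappa> ` nbrs adj S v)"
    then obtain \<kappa> c where [simp]: "a = (\<kappa>, c)" and \<kappa>: "\<kappa> \<in> colorings adj k S"
      and c: "c < k" "c \<notin> \<kappa> ` nbrs adj S v" by auto
    have ext: "\<kappa> \<in> extensional S" using \<kappa> by (auto simp: colorings_def PiE_def)
    have "restrict (\<kappa>(v := c)) S = \<kappa>"
      using ext \<open>v \<notin> S\<close> by (auto simp: fun_eq_iff extensional_def)
    then show "(restrict ((case a of (\<kappa>, c) \<Rightarrow> \<kappa>(v := c))) S, (case a of (\<kappa>, c) \<Rightarrow> \<kappa>(v := c)) v) = a"
      by simp
    have "(case a of (\<kappa>, c) \<Rightarrow> \<kappa>(v := c)) \<in> insert v S \<rightarrow>\<^sub>E {..<k}"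
      using \<kappa> c by (auto simp: colorings_def PiE_def Pi_def extensional_def)
    moreover have "(case a of (\<kappa>, c) \<Rightarrow> \<kappa>(v := c)) x \<noteq> (case a of (\<kappa>, c) \<Rightarrow> \<kappa>(v := c)) y"
      if "x \<in> insert v S" "y \<in> insert v S" "adj x y" for x y
      using that \<kappa> c adj_irrefl \<open>v \<notin> S\<close> by (auto simp: colorings_def nbrs_def adj_sym)
    ultimately show "(case a of (\<kappa>, c) \<Rightarrow> \<kappa>(v := c)) \<in> colorings adj k (insert v S)"
      unfolding colorings_def by blast
    show "h (case a of (\<kappa>, c) \<Rightarrow> \<kappa>(v := c)) = (case a of (\<kappa>, c) \<Rightarrow> h (\<kappa>(v := c)))"
      by simp
  next
    fix \<kappa> assume \<kappa>: "\<kappa> \<in> colorings adj k (insert v S)"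
    then have "\<kappa> \<in> extensional (insert v S)" by (auto simp: colorings_def PiE_def)
    then show "(case (restrict \<kappa> S, \<kappa> v) of (\<kappa>, c) \<Rightarrow> \<kappa>(v := c)) = \<kappa>"
      using \<open>v \<notin> S\<close> by (auto simp: fun_eq_iff extensional_def)
    have "\<kappa> v \<noteq> \<kappa> w" if "w \<in> nbrs adj S v" for w
      using \<kappa> that by (auto simp: colorings_def nbrs_def)
    moreover have "restrict \<kappa> S \<in> colorings adj k S" "\<kappa> v < k"
      using \<kappa> by (auto simp: colorings_def)
    ultimately show "(restrict \<kappa> S, \<kappa> v) \<in> Sigma (colorings adj k S) (\<lambda>\<kappa>. {..<k} - \<kappa> ` nbrs adj S v)"
      using \<open>v \<notin> S\<close> by (auto simp: nbrs_def)
  qed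
  finally show ?thesis by simp
qed

lemma card_colorings_insert_one:
  assumes "finite S" "v \<notin> S" "nbrs adj S v = {p}"
  shows "card (colorings adj k (insert v S)) = card (colorings adj k S) * (k - 1)"
proof -
  have "p \<in> S" using assms by (auto simp: nbrs_def)
  then have "card ({..<k} - \<kappa> ` nbrs adj S v) = k - 1" if "\<kappa> \<in> colorings adj k S" for \<kappa>
    using that assms by (auto simp: colorings_def PiE_def Pi_def)
  then show ?thesis
    using sum_colorings_insert[OF assms(1,2), where h = "\<lambda>_. 1::nat" and k = k] by simp
qed

lemma card_colorings_insert_none:
  assumes "finite S" "v \<notin> S" "nbrs adj S v = {}"
  shows "card (colorings adj k (insert v S)) = card (colorings adj k S) * k"
  using sum_colorings_insert[OF assms(1,2), where h = "\<lambda>_. 1::nat" and k = k] assms by simp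

end

section \<open>Colorings of a cycle\<close>

text \<open>
  An induced cycle is parametrized by a map of period \<open>g\<close> on the naturals, so that its rotations
  are the shifts of the parametrization.
\<close>

locale cycle_graph = adjacency adj for adj :: "'a \<Rightarrow> 'a \<Rightarrow> bool" +
  fixes g :: nat and f :: "nat \<Rightarrow> 'a"
  assumes g_ge_3: "3 \<le> g"
    and f_eq_iff: "f i = f j \<longleftrightarrow> i mod g = j mod g"
    and adj_f_iff: "adj (f i) (f j) \<longleftrightarrow> j mod g = Suc i mod g \<or> i mod g = Suc j mod g"
begin

abbreviation W :: "'a set" where "W \<equiv> range f"

lemma W_eq: "W = f ` {..<g}"
proof -
  have "f i = f (i mod g)" for i by (simp add: f_eq_iff)
  moreover have "i mod g < g" for i using g_ge_3 by simp
  ultimately show ?thesis by (metis (no_types, lifting) imageE image_eqI lessThan_iff subsetI subset_antisym UNIV_I)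
qed

lemma inj_f: "inj_on f {..<g}"
  by (auto simp: inj_on_def f_eq_iff)

lemma finite_W: "finite W" and card_W: "card W = g"
  using inj_f by (auto simp: W_eq card_image)

lemma shift: "cycle_graph adj g (\<lambda>i. f (i + k))"
proof
  have m: "(i + k) mod g = (j + k) mod g \<longleftrightarrow> i mod g = j mod g" for i j
    using cong_add_rcancel_nat[of i k j g] by (simp add: cong_def)
  show "f (i + k) = f (j + k) \<longleftrightarrow> i mod g = j mod g" for i j
    by (simp add: f_eq_iff m)
  show "adj (f (i + k)) (f (j + k)) \<longleftrightarrow> j mod g = Suc i mod g \<or> i mod g = Suc j mod g" for i j
    using m[of j "Suc i"] m[of i "Suc j"] by (simp add: adj_f_iff)
qed (rule g_ge_3)

lemma range_shift: "range (\<lambda>i. f (i + k)) = W"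
proof
  \<comment> \<open>Adding \<open>(g - 1) * k\<close> undoes the shift by \<open>k\<close> modulo
    \<open>g\<close> without subtraction.\<close>
  have "f i = f (i + (g - 1) * k + k)" for i
  proof -
    have *: "i + (g - 1) * k + k = i + k * g" using g_ge_3 by (cases g) auto
    show ?thesis unfolding * by (simp add: f_eq_iff)
  qed
  then show "W \<subseteq> range (\<lambda>i. f (i + k))" by blast
qed auto

text \<open>The bound \<open>m < g - 1\<close> keeps \<open>f m\<close> away from the vertex that
  closes the cycle and would also see \<open>f 0\<close>.\<close>

lemma nbrs_path:
  assumes "0 < m" "m < g - 1"
  shows "nbrs adj (f ` {..<m}) (f m) = {f (m - 1)}"
proof -
  have "adj (f m) (f i) \<longleftrightarrow> i = m - 1" if "i < m" for i
    using that assms by (auto simp: adj_f_iff)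
  then show ?thesis using assms by (auto simp: nbrs_def)
qed

lemma nbrs_last: "nbrs adj (f ` {..<g - 1}) (f (g - 1)) = {f 0, f (g - 2)}"
proof -
  have "adj (f (g - 1)) (f i) \<longleftrightarrow> i = 0 \<or> i = g - 2" if "i < g - 1" for i
    using that g_ge_3 by (auto simp: adj_f_iff)
  then show ?thesis using g_ge_3 by (auto simp: nbrs_def)
qed

lemma path_notin: "m < g \<Longrightarrow> f m \<notin> f ` {..<m}"
  by (auto simp: f_eq_iff)

lemma card_path_colorings:
  assumes "0 < m" "m \<le> g - 1"
  shows "card (colorings adj k (f ` {..<m})) = k * (k - 1) ^ (m - 1)"
  using assms
proof (induction m rule: nat_induct_non_zero)
  case 1
  have "colorings adj k {} = {\<lambda>_. undefined}" by (auto simp: colorings_def)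
  moreover have "card (colorings adj k (insert (f 0) {})) = card (colorings adj k {}) * k"
    by (rule card_colorings_insert_none) (auto simp: nbrs_def)
  ultimately show ?case by (simp add: lessThan_Suc)
next
  case (Suc m)
  then have "card (colorings adj k (insert (f m) (f ` {..<m}))) =
      card (colorings adj k (f ` {..<m})) * (k - 1)"
    by (intro card_colorings_insert_one[OF _ _ nbrs_path] path_notin) auto
  then show ?case
    using Suc by (cases m) (auto simp: lessThan_Suc)
qed

text \<open>
  The recursion behind this formula: the last vertex can be given the color of the first one exactly
  when its predecessor does not have that color.
\<close>

lemma sum_path_ends_equal:
  assumes "0 < m" "m \<le> g - 1" "0 < k"
  shows "(\<Sum>\<kappa>\<in>colorings adj k (f ` {..<m}). of_bool (\<kappa> (f 0) = \<kappa> (f (m - 1))) :: int) =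
    (int k - 1) ^ (m - 1) + (- 1) ^ (m - 1) * (int k - 1)"
  using assms(1,2)
proof (induction m rule: nat_induct_non_zero)
  case 1
  show ?case using card_path_colorings[of 1 k] g_ge_3 by simp
next
  case (Suc m)
  let ?P = "f ` {..<m}"
  let ?h = "\<lambda>\<kappa>. of_bool (\<kappa> (f 0) = \<kappa> (f m)) :: int"
  have m: "0 < m" "m < g - 1" "m < g" using Suc by auto
  have "(\<Sum>\<kappa>\<in>colorings adj k (insert (f m) ?P). ?h \<kappa>) =
      (\<Sum>\<kappa>\<in>colorings adj k ?P. \<Sum>c\<in>{..<k} - \<kappa> ` nbrs adj ?P (f m). ?h (\<kappa>(f m := c)))"
    using path_notin m by (intro sum_colorings_insert) auto
  also have "\<dots> = (\<Sum>\<kappa>\<in>colorings adj k ?P. 1 - of_bool (\<kappa> (f 0) = \<kappa> (f (m - 1))))"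
  proof (rule sum.cong)
    fix \<kappa> assume \<kappa>: "\<kappa> \<in> colorings adj k ?P"
    then have "\<kappa> (f 0) < k" using m by (auto simp: colorings_def PiE_def Pi_def)
    moreover have "f 0 \<noteq> f m" using m by (simp add: f_eq_iff)
    then have "(\<Sum>c\<in>{..<k} - \<kappa> ` nbrs adj ?P (f m). ?h (\<kappa>(f m := c))) =
        (\<Sum>c\<in>{..<k} - {\<kappa> (f (m - 1))}. if c = \<kappa> (f 0) then 1 else 0)"
      using m by (intro sum.cong) (auto simp: nbrs_path)
    ultimately show "(\<Sum>c\<in>{..<k} - \<kappa> ` nbrs adj ?P (f m). ?h (\<kappa>(f m := c))) =
        1 - of_bool (\<kappa> (f 0) = \<kappa> (f (m - 1)))"
      by (auto simp: sum.delta)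
  qed simp
  also have "\<dots> = int k * (int k - 1) ^ (m - 1) -
      ((int k - 1) ^ (m - 1) + (- 1) ^ (m - 1) * (int k - 1))"
    using Suc m assms(3) by (simp add: sum_subtractf card_path_colorings of_nat_diff)
  also have "\<dots> = (int k - 1) ^ m + (- 1) ^ m * (int k - 1)"
    using m by (cases m) (auto simp: algebra_simps)
  finally show ?case by (simp add: lessThan_Suc)
qed

text \<open>The last vertex closes the path and must avoid the colors of both path ends: two colors,
  or one if the ends agree. The result is the chromatic polynomial of a cycle.\<close>

lemma card_cycle_colorings:
  assumes "2 \<le> k"
  shows "int (card (colorings adj k W)) = (int k - 1) ^ g + (- 1) ^ g * (int k - 1)"
proof -
  let ?P = "f ` {..<g - 1}"
  have W: "W = insert (f (g - 1)) ?P"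
    using g_ge_3 lessThan_Suc[of "g - 1"] by (simp add: W_eq)
  have "int (card (colorings adj k W)) =
      (\<Sum>\<kappa>\<in>colorings adj k ?P. int (card ({..<k} - \<kappa> ` nbrs adj ?P (f (g - 1)))))"
    using sum_colorings_insert[of ?P "f (g - 1)" "\<lambda>_. 1::int" k] path_notin[of "g - 1"] g_ge_3
    by (simp add: W)
  also have "\<dots> = (\<Sum>\<kappa>\<in>colorings adj k ?P. int k - 2 + of_bool (\<kappa> (f 0) = \<kappa> (f (g - 2))))"
  proof (rule sum.cong)
    fix \<kappa> assume \<kappa>: "\<kappa> \<in> colorings adj k ?P"
    then have "\<kappa> (f 0) < k" "\<kappa> (f (g - 2)) < k"
      using g_ge_3 by (auto simp: colorings_def PiE_def Pi_def)
    then show "int (card ({..<k} - \<kappa> ` nbrs adj ?P (f (g - 1)))) =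
        int k - 2 + of_bool (\<kappa> (f 0) = \<kappa> (f (g - 2)))"
      unfolding nbrs_last using assms by (auto simp: card_Diff_subset card_insert_if of_nat_diff)
  qed simp
  also have "\<dots> = (int k - 2) * (int k * (int k - 1) ^ (g - 2)) +
      ((int k - 1) ^ (g - 2) + (- 1) ^ (g - 2) * (int k - 1))"
    using g_ge_3 assms sum_path_ends_equal[of "g - 1" k]
    by (simp add: sum.distrib card_path_colorings of_nat_diff numeral_2_eq_2)
  also have "\<dots> = (int k - 1) ^ Suc (Suc (g - 2)) + (- 1) ^ Suc (Suc (g - 2)) * (int k - 1)"
    by (simp add: algebra_simps)
  also have "Suc (Suc (g - 2)) = g" using g_ge_3 by simp
  finally show ?thesis .
qed

lemma card_cycle_colorings_delete:
  assumes "v \<in> W"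
  shows "card (colorings adj 2 (W - {v})) = 2"
proof -
  obtain i where i: "v = f i" using assms by auto
  \<comment> \<open>This rotation puts \<open>v\<close> at index \<open>g - 1\<close>, so deleting
    it leaves the initial path.\<close>
  interpret s: cycle_graph adj g "\<lambda>j. f (j + Suc i)" by (rule shift)
  have "v = f (g - 1 + Suc i)" using g_ge_3 by (simp add: i f_eq_iff)
  moreover have "W = insert (f (g - 1 + Suc i)) ((\<lambda>j. f (j + Suc i)) ` {..<g - 1})"
    using s.W_eq[unfolded range_shift] g_ge_3 lessThan_Suc[of "g - 1"] by simp
  ultimately have "W - {v} = (\<lambda>j. f (j + Suc i)) ` {..<g - 1}"
    using s.path_notin[of "g - 1"] g_ge_3 by auto
  then show ?thesis using s.card_path_colorings[of "g - 1" 2] g_ge_3 by simp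
qed

lemma card_nbrs_cycle:
  assumes "v \<in> W"
  shows "card (nbrs adj W v) = 2"
proof -
  obtain i where i: "v = f i" using assms by auto
  \<comment> \<open>The predecessor of \<open>f i\<close> is written \<open>f (i + (g - 1))\<close>
    since \<open>i - 1\<close> truncates at 0.\<close>
  have "nbrs adj W v = {f (Suc i), f (i + (g - 1))}"
  proof -
    have "i mod g = Suc j mod g \<longleftrightarrow> j mod g = (i + (g - 1)) mod g" for j
    proof -
      interpret s: cycle_graph adj g "\<lambda>j. f (j + 1)" by (rule shift)
      have "i mod g = Suc (i + (g - 1)) mod g" using g_ge_3 by simp
      then show ?thesis using s.f_eq_iff[of j "i + (g - 1)"] by (auto simp: f_eq_iff)
    qed
    then show ?thesis by (auto simp: nbrs_def i adj_f_iff) (auto simp: f_eq_iff)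
  qed
  moreover have "f (Suc i) \<noteq> f (i + (g - 1))"
  proof
    assume "f (Suc i) = f (i + (g - 1))"
    interpret s: cycle_graph adj g "\<lambda>j. f (j + i)" by (rule shift)
    have "f (1 + i) = f (g - 1 + i)" using \<open>f (Suc i) = _\<close> by (simp add: add.commute)
    then show False using s.f_eq_iff[of 1 "g - 1"] g_ge_3 by simp
  qed
  ultimately show ?thesis by simp
qed

end

section \<open>Convexity of powers of two\<close>

text \<open>With \<open>p = 2 ^ s - 1\<close> and \<open>q = 2 ^ t - 1\<close>, the right side is
  \<open>p + q + p * q\<close>, so the defect is \<open>p * q\<close>.\<close>

lemma two_power_add_le:
  fixes s t :: nat
  shows "(2::nat) ^ s - 1 + (2 ^ t - 1) \<le> 2 ^ (s + t) - 1"
    and "(2::nat) ^ s - 1 + (2 ^ t - 1) = 2 ^ (s + t) - 1 \<Longrightarrow> s = 0 \<or> t = 0"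
proof -
  define p q :: nat where "p = 2 ^ s - 1" and "q = 2 ^ t - 1"
  have p: "2 ^ s = Suc p" and q: "2 ^ t = Suc q" by (simp_all add: p_def q_def)
  show "(2::nat) ^ s - 1 + (2 ^ t - 1) \<le> 2 ^ (s + t) - 1"
    unfolding power_add p q by simp
  assume "(2::nat) ^ s - 1 + (2 ^ t - 1) = 2 ^ (s + t) - 1"
  then have "p = 0 \<or> q = 0" unfolding power_add p q by simp
  then show "s = 0 \<or> t = 0"
  proof
    assume "p = 0"
    then have "(2::nat) ^ s = 1" using p by simp
    then show ?thesis by (simp add: power_eq_1_iff)
  next
    assume "q = 0"
    then have "(2::nat) ^ t = 1" using q by simp
    then show ?thesis by (simp add: power_eq_1_iff)
  qed
qed

lemma sum_two_power_le:
  fixes x :: "'b \<Rightarrow> nat"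
  assumes "finite A"
  shows "(\<Sum>v\<in>A. 2 ^ x v - 1) \<le> (2::nat) ^ (\<Sum>v\<in>A. x v) - 1"
  using assms
proof (induction A)
  case (insert a A)
  then have "2 ^ x a - 1 + (\<Sum>v\<in>A. 2 ^ x v - 1) \<le> (2::nat) ^ x a - 1 + (2 ^ (\<Sum>v\<in>A. x v) - 1)"
    by linarith
  also have "\<dots> \<le> 2 ^ (x a + (\<Sum>v\<in>A. x v)) - 1"
    by (rule two_power_add_le(1))
  finally show ?case using insert.hyps by simp
qed simp

text \<open>Equality in total forces equality when one element is split off from the rest; then
  either the rest carries nothing, or the element carries nothing and the induction hypothesis
  applies.\<close>

lemma sum_two_power_eq_concentrated:
  fixes x :: "'b \<Rightarrow> nat"
  assumes "finite A" "0 < (\<Sum>v\<in>A. x v)"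
    "(\<Sum>v\<in>A. 2 ^ x v - 1) = (2::nat) ^ (\<Sum>v\<in>A. x v) - 1"
  shows "\<exists>v\<in>A. x v = (\<Sum>v\<in>A. x v)"
  using assms
proof (induction A)
  case (insert a A)
  define s t where "s = x a" and "t = (\<Sum>v\<in>A. x v)"
  have sum: "(\<Sum>v\<in>insert a A. x v) = s + t"
    using insert.hyps by (simp add: s_def t_def)
  have eq: "2 ^ s - 1 + (\<Sum>v\<in>A. 2 ^ x v - 1) = (2::nat) ^ (s + t) - 1"
    using insert.prems(2) insert.hyps unfolding sum by (simp add: s_def)
  have le: "(\<Sum>v\<in>A. 2 ^ x v - 1) \<le> (2::nat) ^ t - 1"
    unfolding t_def by (rule sum_two_power_le[OF insert.hyps(1)])
  have "(2::nat) ^ s - 1 + (2 ^ t - 1) = 2 ^ (s + t) - 1"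
    using eq le two_power_add_le(1)[of s t] by linarith
  then consider "t = 0" | "s = 0" "0 < t"
    using two_power_add_le(2)[of s t] by blast
  then show ?case
  proof cases
    case 1
    then show ?thesis unfolding sum s_def by simp
  next
    case 2
    then have "(\<Sum>v\<in>A. 2 ^ x v - 1) = (2::nat) ^ t - 1" using eq by simp
    then obtain v where "v \<in> A" "x v = t" using insert.IH 2 unfolding t_def by blast
    then show ?thesis unfolding sum using 2 by auto
  qed
qed simp

text \<open>Only an upper bound on the exponent sum is assumed because for odd cycles the sum runs
  over the cycle only, and excess off the cycle is not seen. The extremal value forces the sum to be
  \<open>l\<close>.\<close>

lemma sum_two_power_concentrated:
  fixes x :: "'b \<Rightarrow> nat"
  assumes "finite A" "(\<Sum>v\<in>A. x v) \<le> l" "0 < l" "(\<Sum>v\<in>A. 2 ^ x v - 1) = (2 :: nat) ^ l - 1"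
  shows "\<exists>v\<in>A. x v = l"
proof -
  define s where "s = (\<Sum>v\<in>A. x v)"
  have "(2::nat) ^ l - 1 \<le> 2 ^ s - 1"
    using sum_two_power_le[OF assms(1), of x] assms(4) s_def by simp
  then have "(2::nat) ^ l \<le> 2 ^ s"
    using one_le_power[of "2::nat" s] by linarith
  then have "s = l" using assms(2) s_def by (simp add: power_increasing_iff)
  then show ?thesis
    using sum_two_power_eq_concentrated[OF assms(1), of x] assms(3,4) s_def by auto
qed

section \<open>Attaching trees to a cycle\<close>

text \<open>A cycle with trees attached, in the form of an induction principle: \<open>v\<close> is
  a leaf on its arrival, though later vertices may still be attached to it.\<close>

inductive grown :: "('a \<Rightarrow> 'a \<Rightarrow> bool) \<Rightarrow> 'a set \<Rightarrow> 'a set \<Rightarrow> bool" for adj W where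
  base: "grown adj W W"
| attach: "grown adj W S \<Longrightarrow> v \<notin> S \<Longrightarrow> nbrs adj S v = {p} \<Longrightarrow> grown adj W (insert v S)"

section \<open>Growth and excess\<close>

context cycle_graph
begin

text \<open>The degree beyond the one a vertex has on entering, hence the number of vertices
  attached to it later. On grown sets the subtraction does not truncate, by
  \<open>card_nbrs_ge\<close>.\<close>

definition excess :: "'a set \<Rightarrow> 'a \<Rightarrow> nat" where
  "excess S v = card (nbrs adj S v) - (if v \<in> W then 2 else 1)"

lemma grown_finite: "grown adj W S \<Longrightarrow> finite S"
  by (induction rule: grown.induct) (auto simp: finite_W)

lemma grown_superset: "grown adj W S \<Longrightarrow> W \<subseteq> S"
  by (induction rule: grown.induct) auto

lemma grown_card: "grown adj W S \<Longrightarrow> g \<le> card S"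
  using card_mono[OF grown_finite grown_superset] card_W by simp

text \<open>Each attached vertex has to avoid one color, that of its only earlier neighbor.\<close>

lemma card_grown_colorings:
  assumes "grown adj W S"
  shows "card (colorings adj k S) = card (colorings adj k W) * (k - 1) ^ (card S - g)"
  using assms
proof (induction rule: grown.induct)
  case base
  show ?case by (simp add: card_W)
next
  case (attach S v p)
  then have "card (insert v S) - g = Suc (card S - g)"
    using grown_card grown_finite by (simp add: Suc_diff_le)
  then show ?case
    using attach card_colorings_insert_one[of S v p k] grown_finite by simp
qed

lemma nbrs_attach:
  assumes "v \<notin> S" "nbrs adj S v = {p}" "w \<in> insert v S"
  shows "nbrs adj (insert v S) w =
    (if w = v then {p} else if w = p then insert v (nbrs adj S w) else nbrs adj S w)"
proof (cases "w = v")
  case True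
  then show ?thesis using assms adj_irrefl by (auto simp: nbrs_def)
next
  case False
  then have "adj w v \<longleftrightarrow> w = p" using assms by (auto simp: nbrs_def intro: adj_sym)
  then show ?thesis using False by (auto simp: nbrs_def)
qed

lemma card_nbrs_attach:
  assumes "finite S" "v \<notin> S" "nbrs adj S v = {p}" "w \<in> insert v S"
  shows "card (nbrs adj (insert v S) w) =
    (if w = v then 1 else if w = p then Suc (card (nbrs adj S w)) else card (nbrs adj S w))"
proof -
  have "v \<notin> nbrs adj S w" using assms by (auto simp: nbrs_def)
  then show ?thesis using nbrs_attach[OF assms(2-4)] assms(1) by auto
qed

lemma card_nbrs_ge:
  assumes "grown adj W S" "w \<in> S"
  shows "(if w \<in> W then 2 else 1) \<le> card (nbrs adj S w)"
  using assms
proof (induction rule: grown.induct)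
  case base
  then show ?case using card_nbrs_cycle by simp
next
  case (attach S v p)
  then show ?case
    using card_nbrs_attach[OF grown_finite attach(2,3,5)] grown_superset by (auto split: if_splits)
qed

lemma excess_attach:
  assumes "grown adj W S" "v \<notin> S" "nbrs adj S v = {p}" "w \<in> insert v S"
  shows "excess (insert v S) w =
    (if w = v then 0 else if w = p then Suc (excess S w) else excess S w)"
proof -
  have "v \<notin> W" using assms grown_superset by auto
  then show ?thesis
    using card_nbrs_attach[OF grown_finite assms(2-4)] card_nbrs_ge[OF assms(1), of w] assms
    unfolding excess_def by (auto split: if_splits)
qed

lemma excess_cycle: "v \<in> W \<Longrightarrow> excess W v = 0"
  by (simp add: excess_def card_nbrs_cycle)

text \<open>Each attachment raises one excess by one, that of \<open>p\<close>, and the new vertex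
  starts at zero.\<close>

lemma sum_excess:
  assumes "grown adj W S"
  shows "(\<Sum>v\<in>S. excess S v) = card S - g"
  using assms
proof (induction rule: grown.induct)
  case base
  show ?case by (simp add: card_W excess_cycle)
next
  case (attach S v p)
  have fin: "finite S" and "p \<in> S" "v \<noteq> p"
    using attach grown_finite by (auto simp: nbrs_def)
  have "(\<Sum>w\<in>insert v S. excess (insert v S) w) = (\<Sum>w\<in>S. excess S w + (if w = p then 1 else 0))"
    using attach fin excess_attach[OF attach(1-3)] by (auto intro!: sum.cong)
  also have "\<dots> = Suc (\<Sum>w\<in>S. excess S w)"
    using fin \<open>p \<in> S\<close> by (simp add: sum.distrib)
  finally show ?case
    using attach fin grown_card by (simp add: Suc_diff_le)
qed

text \<open>Induction along the growth, with two colors. If \<open>w\<close> is \<open>p\<close>,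
  the new vertex becomes isolated and doubles the count, just as the excess of \<open>p\<close>
  grows by one; if \<open>w\<close> is older and not \<open>p\<close>, the color of \<open>v\<close>
  is forced; if \<open>w\<close> is \<open>v\<close>, all of \<open>S\<close> remains and has as
  many 2-colorings as the cycle.\<close>

lemma card_grown_colorings_delete:
  assumes "grown adj W S" "w \<in> S"
  shows "card (colorings adj 2 (S - {w})) =
    2 ^ excess S w * (if w \<in> W then 2 else card (colorings adj 2 W))"
  using assms
proof (induction rule: grown.induct)
  case base
  then show ?case by (simp add: card_cycle_colorings_delete excess_cycle)
next
  case (attach S v p)
  have fin: "finite S" using attach grown_finite by auto
  note ex = excess_attach[OF attach(1-3,5)]
  show ?case
  proof (cases "w = v")
    case True
    then have "w \<notin> W" "insert v S - {w} = S" using attach grown_superset by auto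
    then show ?thesis using True ex card_grown_colorings[OF attach(1), of 2] by simp
  next
    case False
    then have w: "w \<in> S" "insert v S - {w} = insert v (S - {w})" using attach by auto
    have v: "finite (S - {w})" "v \<notin> S - {w}" using fin attach by auto
    have nb: "nbrs adj (S - {w}) v = {p} - {w}" using attach(3) by (auto simp: nbrs_def)
    show ?thesis
    proof (cases "w = p")
      case True
      then show ?thesis
        using card_colorings_insert_none[OF v] nb ex False w attach.IH by simp
    next
      case wp: False
      then have "nbrs adj (S - {w}) v = {p}" using nb by auto
      then show ?thesis
        using card_colorings_insert_one[OF v] ex False wp w attach.IH by simp
    qed
  qed
qed

text \<open>The first vertex attached has its neighbor on the cycle, and the excess of a cycle
  vertex never decreases afterwards.\<close>

lemma grown_excess_on_cycle:
  assumes "grown adj W S"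
  shows "S = W \<or> (\<exists>p\<in>W. 0 < excess S p)"
  using assms
proof (induction rule: grown.induct)
  case (attach S v p)
  have p: "p \<in> S" "p \<noteq> v" using attach by (auto simp: nbrs_def)
  have ex: "excess (insert v S) w = (if w = p then Suc (excess S w) else excess S w)" if "w \<in> W" for w
    using that grown_superset[OF attach(1)] attach(2) excess_attach[OF attach(1-3), of w] by auto
  from attach.IH show ?case
  proof
    assume "S = W"
    then show ?thesis using p ex by auto
  next
    assume "\<exists>p\<in>W. 0 < excess S p"
    then obtain q where "q \<in> W" "0 < excess S q" by blast
    then have "0 < excess (insert v S) q" using ex[of q] by simp
    then show ?thesis using \<open>q \<in> W\<close> by blast
  qed
qed simp

section \<open>Excess concentrated at one vertex\<close>

lemma excess_concentrated:
  assumes "grown adj W S" "v \<in> S" "card S - g \<le> excess S v" "u \<in> S" "u \<noteq> v"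
  shows "excess S u = 0"
proof -
  have "excess S v + excess S u = (\<Sum>w\<in>{v, u}. excess S w)" using assms by simp
  also have "\<dots> \<le> (\<Sum>w\<in>S. excess S w)"
    using assms grown_finite by (intro sum_mono2) auto
  finally show ?thesis using sum_excess[OF assms(1)] assms by simp
qed

text \<open>Some cycle vertex has positive excess, and only \<open>v\<close> can have it.\<close>

lemma excess_concentrated_on_cycle:
  assumes "grown adj W S" "S \<noteq> W" "v \<in> S" "card S - g \<le> excess S v"
  shows "v \<in> W"
proof -
  obtain p where "p \<in> W" "0 < excess S p"
    using grown_excess_on_cycle[OF assms(1)] assms(2) by blast
  then have "p = v"
    using excess_concentrated[OF assms(1,3,4), of p] grown_superset[OF assms(1)] by auto
  then show ?thesis using \<open>p \<in> W\<close> by simp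
qed

text \<open>The excess of \<open>v\<close> is at least the number of vertices off the cycle, so all
  of these are neighbors of \<open>v\<close> (\<open>hub\<close>). All other vertices have minimal
  degree, which excludes further edges leaving the cycle (\<open>W\<close>) and edges off the cycle
  (\<open>L\<close>).\<close>

lemma adj_concentrated:
  assumes S: "grown adj W S" and "v \<in> W" "card S - g \<le> excess S v" "a \<in> S" "b \<in> S"
  shows "adj a b \<longleftrightarrow>
    a \<in> W \<and> b \<in> W \<and> adj a b \<or> a = v \<and> b \<notin> W \<or> b = v \<and> a \<notin> W"
proof -
  have WS: "W \<subseteq> S" and fin: "finite S" using grown_superset grown_finite S by auto
  have split: "nbrs adj S w = nbrs adj W w \<union> nbrs adj (S - W) w" for w
    using WS by (auto simp: nbrs_def)
  have cs: "card (nbrs adj S w) = card (nbrs adj W w) + card (nbrs adj (S - W) w)" for w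
    unfolding split using fin finite_W by (intro card_Un_disjoint) (auto simp: nbrs_def)
  have deg: "card (nbrs adj S w) = excess S w + (if w \<in> W then 2 else 1)" if "w \<in> S" for w
    using card_nbrs_ge[OF S that] by (auto simp: excess_def)
  have "card (nbrs adj (S - W) v) \<ge> card (S - W)"
    using cs[of v] deg[of v] assms WS card_nbrs_cycle[of v] finite_W fin
    by (auto simp: card_Diff_subset card_W)
  then have "nbrs adj (S - W) v = S - W"
    using fin by (intro card_seteq) (auto simp: nbrs_def)
  then have hub: "adj v w" if "w \<in> S" "w \<notin> W" for w
    using that unfolding nbrs_def by blast
  have W: "w = v" if "w \<in> W" "x \<in> S" "x \<notin> W" "adj w x" for w x
  proof (rule ccontr)
    assume "w \<noteq> v"
    moreover have "w \<in> S" "v \<in> S" using WS that(1) assms(2) by auto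
    ultimately have "excess S w = 0" using excess_concentrated[OF S _ assms(3)] by blast
    then have "card (nbrs adj (S - W) w) = 0"
      using cs[of w] deg[OF \<open>w \<in> S\<close>] that(1) card_nbrs_cycle[OF that(1)] by simp
    then show False using that fin by (auto simp: nbrs_def)
  qed
  have L: False if "x \<in> S" "x \<notin> W" "y \<in> S" "y \<notin> W" "adj x y" for x y
  proof -
    have "x \<noteq> v" using that assms(2) by auto
    then have "card (nbrs adj S x) = 1"
      using deg[of x] excess_concentrated[OF S _ assms(3), of x] that WS assms(2) by auto
    moreover have "v \<in> nbrs adj S x" "y \<in> nbrs adj S x"
      using that adj_sym[OF hub[of x]] assms(2) WS by (auto simp: nbrs_def)
    ultimately have "v = y" by (auto simp: card_1_singleton_iff)
    then show False using that assms(2) by auto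
  qed
  show ?thesis
  proof (cases "a \<in> W"; cases "b \<in> W")
    assume "a \<in> W" "b \<notin> W"
    then show ?thesis using hub[of b] W[of a b] assms by auto
  next
    assume "a \<notin> W" "b \<in> W"
    then show ?thesis using hub[of a] W[of b a] assms adj_sym[of a b] adj_sym[of b a] by auto
  next
    assume "a \<notin> W" "b \<notin> W"
    then show ?thesis using L[of a b] assms by auto
  next
    assume "a \<in> W" "b \<in> W"
    then show ?thesis using assms by auto
  qed
qed

section \<open>Coloring counts in terms of excess\<close>

lemma card_two_colorings_cycle: "card (colorings adj 2 W) = (if even g then 2 else 0)"
  using card_cycle_colorings[of 2] by (auto split: if_splits)

text \<open>For odd \<open>g\<close>, deleting a vertex off the cycle keeps an odd cycle, which has
  no 2-coloring, so only cycle vertices contribute.\<close>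

lemma sum_card_colorings_delete:
  assumes "grown adj W S"
  defines "A \<equiv> if even g then S else W"
  shows "(\<Sum>w\<in>S. card (colorings adj 2 (S - {w}))) =
    2 * (card A + (\<Sum>w\<in>A. 2 ^ excess S w - 1))"
proof -
  have fin: "finite S" and WS: "W \<subseteq> S" using assms grown_finite grown_superset by auto
  have A: "A \<subseteq> S" "finite A" using WS fin finite_W by (auto simp: A_def)
  have "(\<Sum>w\<in>S. card (colorings adj 2 (S - {w}))) = (\<Sum>w\<in>S. if w \<in> A then 2 * 2 ^ excess S w else 0)"
    using card_grown_colorings_delete[OF assms(1)]
    by (intro sum.cong) (auto simp: card_two_colorings_cycle A_def)
  also have "\<dots> = (\<Sum>w\<in>A. 2 * 2 ^ excess S w)"
    using A fin by (simp add: sum.If_cases Int_absorb1)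
  \<comment> \<open>Splitting off 1 brings each term to the form \<open>2 ^ e - 1\<close> of the
    convexity lemmas.\<close>
  also have "\<dots> = (\<Sum>w\<in>A. 2 * (1 + (2 ^ excess S w - 1)))" by simp
  also have "\<dots> = 2 * (card A + (\<Sum>w\<in>A. 2 ^ excess S w - 1))"
    by (simp only: sum.distrib sum_distrib_left[symmetric]) simp
  finally show ?thesis .
qed

lemma card_three_colorings:
  assumes "grown adj W S"
  shows "int (card (colorings adj 3 S)) = 2 ^ card S + (- 1) ^ g * 2 ^ (card S - g + 1)"
proof -
  have "int (card (colorings adj 3 S)) = (2 ^ g + (- 1) ^ g * 2) * 2 ^ (card S - g)"
    using card_grown_colorings[OF assms, of 3] card_cycle_colorings[of 3] by simp
  also have "\<dots> = 2 ^ (g + (card S - g)) + (- 1) ^ g * 2 ^ (card S - g + 1)"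
    by (simp add: algebra_simps power_add)
  finally show ?thesis using grown_card[OF assms] by simp
qed

end

section \<open>Recognizing concentrated excess\<close>

text \<open>The primed graph is the one known to have a hub. Three colors give the cycle length; the
  deletion sums then show that the excesses of the unprimed graph attain the convexity bound
  too.\<close>

lemma concentrated_excess_of_equal_counts:
  assumes "cycle_graph adj g f" and S: "grown adj (range f) S"
    and "cycle_graph adj' g' f'" and S': "grown adj' (range f') S'"
    and card_eq: "card S = card S'"
    and three: "card (colorings adj 3 S) = card (colorings adj' 3 S')"
    and deleted: "(\<Sum>w\<in>S. card (colorings adj 2 (S - {w}))) =
      (\<Sum>w\<in>S'. card (colorings adj' 2 (S' - {w})))"
    and hub: "v' \<in> range f'" "card S' - g' \<le> cycle_graph.excess adj' f' S' v'" "g' < card S'"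
  shows "g = g'" and "\<exists>v\<in>range f. card S - g \<le> cycle_graph.excess adj f S v"
proof -
  interpret a: cycle_graph adj g f by fact
  interpret b: cycle_graph adj' g' f' by fact
  let ?l = "card S' - g'"
  have pow: "(- 1) ^ g * 2 ^ (card S - g + 1) = (- 1 :: int) ^ g' * 2 ^ (card S - g' + 1)"
    using three a.card_three_colorings[OF S] b.card_three_colorings[OF S'] card_eq by simp
  \<comment> \<open>Taking absolute values drops the signs, so that the exponents can be compared
    before the parities of \<open>g\<close> and \<open>g'\<close> are known to agree.\<close>
  then have "\<bar>(- 1) ^ g * 2 ^ (card S - g + 1)\<bar> = \<bar>(- 1 :: int) ^ g' * 2 ^ (card S - g' + 1)\<bar>"
    by simp
  then have "(2::int) ^ (card S - g + 1) = 2 ^ (card S - g' + 1)"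
    by (simp add: abs_mult power_abs)
  then have "card S - g + 1 = card S - g' + 1" by (rule power_inject_exp[THEN iffD1, rotated]) simp
  then show g: "g = g'"
    using a.grown_card[OF S] b.grown_card[OF S'] card_eq by simp
  define A where "A = (if even g then S else range f)"
  define A' where "A' = (if even g' then S' else range f')"
  have finA: "finite A" "A \<subseteq> S"
    using a.grown_finite[OF S] a.grown_superset[OF S] a.finite_W by (auto simp: A_def)
  have A': "finite A'" "A' \<subseteq> S'" "v' \<in> A'"
    using b.grown_finite[OF S'] b.grown_superset[OF S'] b.finite_W hub by (auto simp: A'_def)
  have "card A = card A'"
    using g card_eq a.card_W b.card_W by (simp add: A_def A'_def)
  then have eq: "(\<Sum>w\<in>A. 2 ^ a.excess S w - 1) = (\<Sum>w\<in>A'. 2 ^ b.excess S' w - 1 :: nat)"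
    using deleted a.sum_card_colorings_delete[OF S] b.sum_card_colorings_delete[OF S']
    by (simp add: A_def A'_def)
  have v'S: "v' \<in> S'" using A' by auto
  have zero: "b.excess S' w = 0" if "w \<in> S'" "w \<noteq> v'" for w
    using b.excess_concentrated[OF S' v'S hub(2) that] .
  have "b.excess S' v' = ?l"
    using b.sum_excess[OF S'] zero sum.remove[OF b.grown_finite[OF S'] v'S, of "b.excess S'"] by simp
  moreover have "(\<Sum>w\<in>A' - {v'}. 2 ^ b.excess S' w - 1 :: nat) = 0"
  proof (intro sum.neutral ballI)
    fix w assume "w \<in> A' - {v'}"
    then show "2 ^ b.excess S' w - 1 = (0::nat)" using zero[of w] A'(2) by auto
  qed
  ultimately have "(\<Sum>w\<in>A'. 2 ^ b.excess S' w - 1) = (2::nat) ^ ?l - 1"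
    using sum.remove[OF A'(1,3), of "\<lambda>w. 2 ^ b.excess S' w - 1 :: nat"] by simp
  moreover have "(\<Sum>w\<in>A. a.excess S w) \<le> ?l"
    using sum_mono2[OF a.grown_finite[OF S] finA(2), of "a.excess S"] a.sum_excess[OF S] card_eq g
    by simp
  ultimately obtain v where v: "v \<in> A" "a.excess S v = ?l"
    using sum_two_power_concentrated[OF finA(1), of "a.excess S" ?l] eq hub(3) by auto
  \<comment> \<open>For even \<open>g\<close> the set \<open>A\<close> is all of \<open>S\<close>,
    so \<open>v\<close> still has to be located on the cycle.\<close>
  have "S \<noteq> range f" using a.card_W g hub(3) card_eq by auto
  then have "v \<in> range f"
    using a.excess_concentrated_on_cycle[OF S, of v] v finA g card_eq by auto
  then show "\<exists>v\<in>range f. card S - g \<le> a.excess S v"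
    using v card_eq g by (intro bexI[of _ v]) auto
qed

section \<open>Counting colorings through the chromatic symmetric function\<close>

text \<open>Groups the colorings by monomial. \<open>M\<close> may contain monomials that
  \<open>G\<close> does not attain, so that one \<open>M\<close> can serve two graphs.\<close>

lemma card_colorings_of_monomials:
  assumes "finite (pverts G)" "finite M"
    and M: "coloring_monomial G ` {\<kappa> \<in> proper_colorings G. P (coloring_monomial G \<kappa>)} \<subseteq> M"
      "\<And>m. m \<in> M \<Longrightarrow> P m"
  shows "int (card {\<kappa> \<in> proper_colorings G. P (coloring_monomial G \<kappa>)}) =
    (\<Sum>m\<in>M. chromatic_symmetric_function G m)"
proof -
  have *: "{\<kappa> \<in> proper_colorings G. P (coloring_monomial G \<kappa>)} =
      (\<Union>m\<in>M. {\<kappa> \<in> proper_colorings G. coloring_monomial G \<kappa> = m})"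
    using M by auto
  show ?thesis
    unfolding * using assms(2) finite_colorings_of_monomial[OF assms(1)]
    by (subst card_UN_disjoint) (auto simp: chromatic_symmetric_function_def)
qed

text \<open>\<open>P\<close> sees only the monomial, so both counts are the same finite sum of
  coefficients, taken over the monomials attained in either graph.\<close>

lemma card_colorings_of_monomials_eq:
  assumes "finite (pverts G)" "finite (pverts H)"
    and X: "chromatic_symmetric_function G = chromatic_symmetric_function H"
    and fin: "finite {\<kappa> \<in> proper_colorings G. P (coloring_monomial G \<kappa>)}"
      "finite {\<kappa> \<in> proper_colorings H. P (coloring_monomial H \<kappa>)}"
  shows "card {\<kappa> \<in> proper_colorings G. P (coloring_monomial G \<kappa>)} =
    card {\<kappa> \<in> proper_colorings H. P (coloring_monomial H \<kappa>)}"
proof -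
  define M where "M = coloring_monomial G ` {\<kappa> \<in> proper_colorings G. P (coloring_monomial G \<kappa>)} \<union>
    coloring_monomial H ` {\<kappa> \<in> proper_colorings H. P (coloring_monomial H \<kappa>)}"
  have M: "finite M" "\<And>m. m \<in> M \<Longrightarrow> P m" using fin by (auto simp: M_def)
  have "int (card {\<kappa> \<in> proper_colorings G. P (coloring_monomial G \<kappa>)}) =
      (\<Sum>m\<in>M. chromatic_symmetric_function G m)"
    by (rule card_colorings_of_monomials[OF assms(1) M(1) _ M(2)]) (auto simp: M_def)
  also have "\<dots> = int (card {\<kappa> \<in> proper_colorings H. P (coloring_monomial H \<kappa>)})"
    unfolding X
    by (rule card_colorings_of_monomials[OF assms(2) M(1) _ M(2), symmetric]) (auto simp: M_def)
  finally have "int (card {\<kappa> \<in> proper_colorings G. P (coloring_monomial G \<kappa>)}) =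
      int (card {\<kappa> \<in> proper_colorings H. P (coloring_monomial H \<kappa>)})" .
  then show ?thesis by simp
qed

section \<open>Reading the use of colors off a monomial\<close>

lemma lookup_coloring_monomial:
  assumes "finite (pverts G)"
  shows "Poly_Mapping.lookup (coloring_monomial G \<kappa>) i = card {v \<in> pverts G. \<kappa> v = i}"
proof -
  have "Poly_Mapping.lookup (coloring_monomial G \<kappa>) i = (\<Sum>v\<in>pverts G. if \<kappa> v = i then 1 else (0::nat))"
    by (simp add: coloring_monomial_def lookup_sum lookup_single when_def del: One_nat_def)
  also have "\<dots> = card {v \<in> pverts G. \<kappa> v = i}"
    using assms by (subst sum.inter_filter[symmetric]) auto
  finally show ?thesis .
qed

lemma keys_coloring_monomial:
  "finite (pverts G) \<Longrightarrow> Poly_Mapping.keys (coloring_monomial G \<kappa>) = \<kappa> ` pverts G"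
  by (auto simp: in_keys_iff lookup_coloring_monomial)

context pair_wf_digraph
begin

abbreviation adj :: "'a \<Rightarrow> 'a \<Rightarrow> bool" where
  "adj u v \<equiv> (u, v) \<in> parcs G"

lemma proper_colorings_iff:
  "\<kappa> \<in> proper_colorings G \<longleftrightarrow> \<kappa> \<in> extensional (pverts G) \<and>
    (\<forall>u\<in>pverts G. \<forall>v\<in>pverts G. adj u v \<longrightarrow> \<kappa> u \<noteq> \<kappa> v)"
  by (auto simp: proper_colorings_def PiE_def dest: in_arcsD1 in_arcsD2)

lemma proper_colorings_keys:
  assumes "finite (pverts G)"
  shows "{\<kappa> \<in> proper_colorings G. Poly_Mapping.keys (coloring_monomial G \<kappa>) \<subseteq> {..<k}} =
    colorings adj k (pverts G)"
  using assms by (auto simp: proper_colorings_iff keys_coloring_monomial colorings_def PiE_def)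

text \<open>Color \<open>k\<close> has exponent 1 exactly if a unique vertex \<open>v\<close>
  carries it. Deleting \<open>v\<close> leaves a coloring with colors below \<open>k\<close>;
  conversely color \<open>k\<close> fits at \<open>v\<close>, since no other vertex has it.\<close>

lemma card_proper_colorings_once:
  assumes "finite (pverts G)" and irrefl: "\<And>v. \<not> adj v v"
  shows "card {\<kappa> \<in> proper_colorings G. Poly_Mapping.keys (coloring_monomial G \<kappa>) \<subseteq> {..<Suc k} \<and>
      Poly_Mapping.lookup (coloring_monomial G \<kappa>) k = 1} =
    (\<Sum>v\<in>pverts G. card (colorings adj k (pverts G - {v})))"
    (is "card ?L = _")
proof -
  let ?V = "pverts G"
  let ?D = "Sigma ?V (\<lambda>v. colorings adj k (?V - {v}))"
  let ?\<phi> = "\<lambda>(v, \<kappa>). \<kappa>(v := k)"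
  have D: "\<kappa> x \<noteq> k" "\<kappa> x < k" if "(v, \<kappa>) \<in> ?D" "x \<in> ?V" "x \<noteq> v" for v \<kappa> x
    using that by (auto simp: colorings_def PiE_def Pi_def)
  have "inj_on ?\<phi> ?D"
  proof (rule inj_onI, clarify)
    fix v \<kappa> w \<mu>
    assume v: "v \<in> ?V" "\<kappa> \<in> colorings adj k (?V - {v})"
      and w: "w \<in> ?V" "\<mu> \<in> colorings adj k (?V - {w})"
      and eq: "\<kappa>(v := k) = \<mu>(w := k)"
    have "v = w"
    proof (rule ccontr)
      assume "v \<noteq> w"
      then have "\<mu> v = k" using fun_cong[OF eq, of v] by simp
      then show False using D[of w \<mu> v] v w \<open>v \<noteq> w\<close> by auto
    qed
    \<comment> \<open>Colorings are \<open>undefined\<close> off their domain, so the two also agree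
      at the vertex that was overwritten.\<close>
    moreover have "\<kappa> v = undefined" "\<mu> w = undefined"
      using v w by (auto simp: colorings_def PiE_def extensional_def)
    moreover have "\<kappa> x = \<mu> x" if "x \<noteq> v" "x \<noteq> w" for x
      using fun_cong[OF eq, of x] that by simp
    ultimately have "\<kappa> x = \<mu> x" for x by (cases "x = v") auto
    then show "v = w \<and> \<kappa> = \<mu>" using \<open>v = w\<close> by auto
  qed
  moreover have "?\<phi> ` ?D = ?L"
  proof (intro equalityI subsetI)
    fix \<mu> assume "\<mu> \<in> ?\<phi> ` ?D"
    then obtain v \<kappa> where \<mu>: "\<mu> = \<kappa>(v := k)" and v: "(v, \<kappa>) \<in> ?D" by auto
    have "{x \<in> ?V. \<mu> x = k} = {v}" using D[OF v] v by (auto simp: \<mu>)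
    moreover have "\<mu> ` ?V \<subseteq> {..<Suc k}" using D[OF v] by (auto simp: \<mu> less_Suc_eq)
    moreover have "\<mu> \<in> extensional ?V"
      using v by (auto simp: \<mu> colorings_def PiE_def extensional_def)
    moreover have "\<mu> x \<noteq> \<mu> y" if "x \<in> ?V" "y \<in> ?V" "adj x y" for x y
    proof (cases "x = v \<or> y = v")
      case True
      then show ?thesis using D[OF v] that irrefl by (auto simp: \<mu>)
    next
      case False
      then show ?thesis using v that by (auto simp: \<mu> colorings_def)
    qed
    ultimately show "\<mu> \<in> ?L"
      using assms(1) by (simp add: proper_colorings_iff keys_coloring_monomial lookup_coloring_monomial)
  next
    fix \<mu> assume "\<mu> \<in> ?L"
    then have ext: "\<mu> \<in> extensional ?V" and proper: "\<And>x y. x \<in> ?V \<Longrightarrow> y \<in> ?V \<Longrightarrow> adj x y \<Longrightarrow> \<mu> x \<noteq> \<mu> y"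
      and range: "\<mu> ` ?V \<subseteq> {..<Suc k}" and "card {v \<in> ?V. \<mu> v = k} = 1"
      using assms(1) by (auto simp: proper_colorings_iff keys_coloring_monomial lookup_coloring_monomial)
    then obtain v where v: "{x \<in> ?V. \<mu> x = k} = {v}" by (auto simp: card_1_singleton_iff)
    then have v': "v \<in> ?V" "\<mu> v = k" and nk: "\<And>x. x \<in> ?V - {v} \<Longrightarrow> \<mu> x \<noteq> k" by auto
    have "restrict \<mu> (?V - {v}) \<in> colorings adj k (?V - {v})"
      unfolding colorings_def
    proof (intro CollectI conjI ballI impI)
      have "\<mu> x < k" if "x \<in> ?V - {v}" for x
        using range nk[OF that] that by (auto simp: image_subset_iff less_Suc_eq)
      then show "restrict \<mu> (?V - {v}) \<in> ?V - {v} \<rightarrow>\<^sub>E {..<k}" by auto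
    next
      fix x y assume "x \<in> ?V - {v}" "y \<in> ?V - {v}" "adj x y"
      then show "restrict \<mu> (?V - {v}) x \<noteq> restrict \<mu> (?V - {v}) y" using proper[of x y] by auto
    qed
    moreover have "\<mu> = (restrict \<mu> (?V - {v}))(v := k)"
      using ext v' by (auto simp: fun_eq_iff extensional_def)
    ultimately show "\<mu> \<in> ?\<phi> ` ?D"
      using v' by (intro image_eqI[of _ _ "(v, restrict \<mu> (?V - {v}))"]) auto
  qed
  ultimately have "card ?L = card ?D" using card_image[of ?\<phi> ?D] by simp
  also have "\<dots> = (\<Sum>v\<in>?V. card (colorings adj k (?V - {v})))"
    using assms(1) by (simp add: finite_colorings)
  finally show ?thesis .
qed

end

lemma card_colorings_eq_of_csf_eq:
  assumes "pair_wf_digraph G" "finite (pverts G)" "pair_wf_digraph H" "finite (pverts H)"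
    and X: "chromatic_symmetric_function G = chromatic_symmetric_function H"
  shows "card (colorings (\<lambda>u v. (u, v) \<in> parcs G) k (pverts G)) =
    card (colorings (\<lambda>u v. (u, v) \<in> parcs H) k (pverts H))"
proof -
  interpret G: pair_wf_digraph G by fact
  interpret H: pair_wf_digraph H by fact
  show ?thesis
    using card_colorings_of_monomials_eq[OF assms(2,4) X, of "\<lambda>m. Poly_Mapping.keys m \<subseteq> {..<k}"]
    by (simp add: G.proper_colorings_keys H.proper_colorings_keys assms finite_colorings)
qed

lemma sum_card_colorings_delete_eq_of_csf_eq:
  assumes "pair_loopfree_digraph G" "finite (pverts G)" "pair_loopfree_digraph H" "finite (pverts H)"
    and X: "chromatic_symmetric_function G = chromatic_symmetric_function H"
  shows "(\<Sum>v\<in>pverts G. card (colorings (\<lambda>u v. (u, v) \<in> parcs G) k (pverts G - {v}))) =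
    (\<Sum>v\<in>pverts H. card (colorings (\<lambda>u v. (u, v) \<in> parcs H) k (pverts H - {v})))"
proof -
  interpret G: pair_loopfree_digraph G by fact
  interpret H: pair_loopfree_digraph H by fact
  let ?P = "\<lambda>m. Poly_Mapping.keys m \<subseteq> {..<Suc k} \<and> Poly_Mapping.lookup m k = 1"
  have irrefl: "\<not> G.adj v v" "\<not> H.adj w w" for v w
    using G.pair_no_loops[of "(v, v)"] H.pair_no_loops[of "(w, w)"] by auto
  have "{\<kappa> \<in> proper_colorings G. ?P (coloring_monomial G \<kappa>)} \<subseteq> colorings G.adj (Suc k) (pverts G)"
    unfolding G.proper_colorings_keys[OF assms(2), of "Suc k", symmetric] by blast
  then have "finite {\<kappa> \<in> proper_colorings G. ?P (coloring_monomial G \<kappa>)}"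
    by (rule finite_subset) (rule finite_colorings[OF assms(2)])
  moreover have "{\<kappa> \<in> proper_colorings H. ?P (coloring_monomial H \<kappa>)} \<subseteq> colorings H.adj (Suc k) (pverts H)"
    unfolding H.proper_colorings_keys[OF assms(4), of "Suc k", symmetric] by blast
  then have "finite {\<kappa> \<in> proper_colorings H. ?P (coloring_monomial H \<kappa>)}"
    by (rule finite_subset) (rule finite_colorings[OF assms(4)])
  ultimately have "card {\<kappa> \<in> proper_colorings G. ?P (coloring_monomial G \<kappa>)} =
      card {\<kappa> \<in> proper_colorings H. ?P (coloring_monomial H \<kappa>)}"
    by (rule card_colorings_of_monomials_eq[OF assms(2,4) X])
  then show ?thesis
    by (simp only: G.card_proper_colorings_once[OF assms(2) irrefl(1)]
        H.card_proper_colorings_once[OF assms(4) irrefl(2)])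
qed

section \<open>The structure of connected unicyclic graphs\<close>

lemma pcas_nth_Suc: "pcas u p v \<Longrightarrow> Suc i < length p \<Longrightarrow> fst (p ! Suc i) = snd (p ! i)"
proof (induction p arbitrary: u i)
  case (Cons e p)
  then show ?case by (cases i; cases p) auto
qed simp

lemma pcas_hd: "pcas u p v \<Longrightarrow> p \<noteq> [] \<Longrightarrow> fst (p ! 0) = u"
  by (cases p) auto

lemma pcas_last: "pcas u p v \<Longrightarrow> p \<noteq> [] \<Longrightarrow> snd (p ! (length p - 1)) = v"
proof (induction p arbitrary: u)
  case (Cons e p)
  then show ?case by (cases p) auto
qed simp

lemma rtrancl_along_periodic:
  assumes "\<And>i. (f i, f (Suc i)) \<in> R" and "0 < g" and period: "\<And>i k. f (i + k * g) = f i"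
  shows "(f i, f j) \<in> R\<^sup>*"
proof -
  have "(f i, f (i + k)) \<in> R\<^sup>*" for k
  proof (induction k)
    case (Suc k)
    then show ?case using assms(1)[of "i + k"] by (auto intro: rtrancl.rtrancl_into_rtrancl)
  qed simp
  \<comment> \<open>Steps only go forward, so \<open>j\<close> is replaced by the equivalent index
    \<open>j + i * g\<close>, which is at least \<open>i\<close>.\<close>
  moreover have "j + i * g = i + (j + i * g - i)" using \<open>0 < g\<close> by (cases g) auto
  ultimately have "(f i, f (j + i * g)) \<in> R\<^sup>*" by metis
  then show ?thesis unfolding period .
qed

context pair_graph
begin

lemma adjacency: "adjacency adj"
  using arcs_symmetric no_loops' by unfold_locales blast+

text \<open>\<open>R\<close> will be the arc set without one edge; keeping the arcs of the walk
  inside \<open>R\<close> makes the walk avoid that edge.\<close>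

lemma awalk_of_rtrancl:
  assumes "(u, v) \<in> R\<^sup>*" "R \<subseteq> parcs G" "u \<in> pverts G"
  shows "\<exists>p. awalk u p v \<and> set p \<subseteq> R"
  using assms(1)
proof (induction rule: rtrancl_induct)
  case base
  then show ?case using assms(3) by (intro exI[of _ "[]"]) (simp add: awalk_Nil_iff)
next
  case (step y z)
  then obtain p where p: "awalk u p y" "set p \<subseteq> R" by blast
  have "awalk y [(y, z)] z"
    using step(2) assms(2) by (auto simp: awalk_simps dest: in_arcsD1 in_arcsD2)
  then have "awalk u (p @ [(y, z)]) z" using p(1) by (rule awalk_appendI[rotated])
  then show ?case using p step(2) by (intro exI[of _ "p @ [(y, z)]"]) auto
qed

text \<open>A walk from \<open>u\<close> to \<open>v\<close> around the edge is shortened to a path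
  and closed by \<open>(v, u)\<close>: an edge that is not a bridge lies on a cycle.\<close>

lemma edge_on_cycle:
  assumes "adj u v" "(u, v) \<in> (parcs G - {(u, v), (v, u)})\<^sup>*"
  shows "\<exists>E\<in>cycle_subgraphs G. {u, v} \<in> E"
proof -
  have uv: "u \<in> pverts G" "v \<in> pverts G" "u \<noteq> v" "adj v u"
    using in_arcsD1[OF assms(1)] in_arcsD2[OF assms(1)] no_loops'[OF assms(1)]
      arcs_symmetric[OF assms(1)] by simp_all
  obtain p where p: "awalk u p v" "set p \<subseteq> parcs G - {(u, v), (v, u)}"
    using awalk_of_rtrancl[OF assms(2) _ uv(1)] by auto
  define q where "q = awalk_to_apath p"
  have q: "apath u q v" "set q \<subseteq> parcs G - {(u, v), (v, u)}"
    using apath_awalk_to_apath[OF p(1)] awalk_to_apath_subset[OF p(1)] p(2) by (auto simp: q_def)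
  then have aw: "awalk u q v" and dist: "distinct (awalk_verts u q)" by (auto simp: apath_def)
  \<comment> \<open>Length 0 would give \<open>u = v\<close>, and length 1 would use the removed arc
    \<open>(u, v)\<close>. With \<open>(v, u)\<close> appended, the cycle has the required length of
    at least 3.\<close>
  have "2 \<le> length q"
  proof (cases q)
    case Nil
    then show ?thesis using aw uv(3) by (simp add: awalk_Nil_iff)
  next
    case (Cons e q')
    have "q' \<noteq> []"
    proof
      assume "q' = []"
      then have "e = (u, v)" using aw unfolding Cons awalk_def by (cases e) simp
      then show False using q(2) Cons by simp
    qed
    then show ?thesis using Cons by (cases q') simp_all
  qed
  have vu: "awalk v [(v, u)] u" using uv by (simp add: awalk_def)
  have closed: "awalk u (q @ [(v, u)]) u" by (rule awalk_appendI[OF aw vu])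
  have "awalk_verts u (q @ [(v, u)]) = awalk_verts u q @ [u]"
    using awalk_verts_append[OF closed] by simp
  moreover obtain ws where ws: "awalk_verts u q = u # ws"
    using awhd_of_awalk[OF aw] by (cases "awalk_verts u q") auto
  ultimately have "distinct (tl (awalk_verts u (q @ [(v, u)])))" using dist by simp
  with closed have "cycle (q @ [(v, u)])" unfolding cycle_def by (intro exI[of _ u] conjI) simp_all
  then have "(\<lambda>(u, v). {u, v}) ` set (q @ [(v, u)]) \<in> cycle_subgraphs G"
    using \<open>2 \<le> length q\<close> unfolding cycle_subgraphs_def
    by (intro CollectI exI[of _ "q @ [(v, u)]"] conjI refl) simp_all
  moreover have "{u, v} \<in> (\<lambda>(u, v). {u, v}) ` set (q @ [(v, u)])"
    by (rule image_eqI[of _ _ "(v, u)"]) (simp_all add: insert_commute)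
  ultimately show ?thesis by (rule bexI[rotated])
qed

lemma cycle_parametrization:
  assumes "cycle p"
  defines "f \<equiv> \<lambda>i. snd (p ! (i mod length p))"
  shows "f i = f j \<longleftrightarrow> i mod length p = j mod length p"
    and "(f i, f (Suc i)) \<in> parcs G"
    and "(\<lambda>(u, v). {u, v}) ` set p = range (\<lambda>i. {f i, f (Suc i)})"
proof -
  obtain u where aw: "awalk u p u" and dist: "distinct (tl (awalk_verts u p))" and "p \<noteq> []"
    using assms(1) unfolding cycle_def by blast
  have cas: "pcas u p u" and arcs: "set p \<subseteq> parcs G" using aw by (auto simp: awalk_def)
  have "awalk_verts u p = fst (hd p) # map snd p"
    using awalk_verts_conv'[OF cas] \<open>p \<noteq> []\<close> by simp
  then have dist: "distinct (map snd p)" using dist by simp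
  have g: "length p > 0" using \<open>p \<noteq> []\<close> by simp
  have lt: "i mod length p < length p" for i using g by simp
  show "f i = f j \<longleftrightarrow> i mod length p = j mod length p"
    using nth_eq_iff_index_eq[OF dist, of "i mod length p" "j mod length p"] lt
    by (simp add: f_def)
  \<comment> \<open>\<open>f i\<close> is the head of arc \<open>i\<close>, hence the tail of the
    next arc. The wrap-around case uses that the walk is closed.\<close>
  have step: "p ! (Suc i mod length p) = (f i, f (Suc i))" for i
  proof (rule prod_eqI)
    show "snd (p ! (Suc i mod length p)) = snd (f i, f (Suc i))" by (simp add: f_def)
    show "fst (p ! (Suc i mod length p)) = fst (f i, f (Suc i))"
    proof (cases "Suc (i mod length p) = length p")
      case True
      then have "Suc i mod length p = 0" "i mod length p = length p - 1" by (simp_all add: mod_Suc)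
      then show ?thesis using pcas_hd[OF cas] pcas_last[OF cas] \<open>p \<noteq> []\<close> by (simp add: f_def)
    next
      case False
      then have "Suc i mod length p = Suc (i mod length p)" by (simp add: mod_Suc)
      moreover have "Suc (i mod length p) < length p" using lt[of i] False by simp
      ultimately show ?thesis using pcas_nth_Suc[OF cas, of "i mod length p"] by (simp add: f_def)
    qed
  qed
  show "(f i, f (Suc i)) \<in> parcs G"
    using nth_mem[OF lt[of "Suc i"]] arcs unfolding step by blast
  have "set p = range (\<lambda>i. (f i, f (Suc i)))"
  proof (intro equalityI subsetI)
    fix e assume "e \<in> set p"
    then obtain k where k: "k < length p" "e = p ! k" by (auto simp: in_set_conv_nth)
    \<comment> \<open>\<open>k + (length p - 1)\<close> stands for \<open>k - 1\<close> modulo the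
      length, the index whose successor is that of arc \<open>k\<close>.\<close>
    have "Suc (k + (length p - 1)) mod length p = k" using k g by simp
    then have "e = (f (k + (length p - 1)), f (Suc (k + (length p - 1))))"
      using step[of "k + (length p - 1)"] k by simp
    then show "e \<in> range (\<lambda>i. (f i, f (Suc i)))" by blast
  next
    fix e assume "e \<in> range (\<lambda>i. (f i, f (Suc i)))"
    then obtain i where "e = p ! (Suc i mod length p)" unfolding step by blast
    then show "e \<in> set p" using nth_mem[OF lt[of "Suc i"]] by simp
  qed
  then show "(\<lambda>(u, v). {u, v}) ` set p = range (\<lambda>i. {f i, f (Suc i)})"
    by (simp add: image_image)
qed

end

section \<open>The unique cycle and the trees attached to it\<close>

locale connected_unicyclic_graph = pair_graph G for G :: "'a pair_pre_digraph" +
  assumes conn: "Digraph_Component.connected (with_proj G)"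
    and unicyclic: "unicyclic G"
begin

lemma obtain_cycle_graph:
  obtains g f where "cycle_graph adj g f"
    and "cycle_subgraphs G = {range (\<lambda>i. {f i, f (Suc i)})}"
proof -
  obtain E where E: "cycle_subgraphs G = {E}"
    using unicyclic unfolding unicyclic_def by blast
  then have "E \<in> cycle_subgraphs G" by simp
  then obtain p where p: "cycle p" "3 \<le> length p" and Ep: "E = (\<lambda>(u, v). {u, v}) ` set p"
    unfolding cycle_subgraphs_def by blast
  define g where "g = length p"
  define f where "f i = snd (p ! (i mod length p))" for i
  have eq: "f i = f j \<longleftrightarrow> i mod g = j mod g" for i j
    unfolding f_def g_def by (rule cycle_parametrization(1)[OF p(1)])
  have arc: "adj (f i) (f (Suc i))" for i
    unfolding f_def by (rule cycle_parametrization(2)[OF p(1)])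
  have E': "E = range (\<lambda>i. {f i, f (Suc i)})"
    unfolding Ep f_def by (rule cycle_parametrization(3)[OF p(1)])
  have period: "f (i + k * g) = f i" for i k by (simp add: eq)
  have Suc_eq: "Suc i mod g = Suc j mod g" if "i mod g = j mod g" for i j
    using that by (metis mod_Suc_eq)
  \<comment> \<open>The cycle is induced: the ends of a chord are joined around the cycle without
    using the chord, so the chord would lie on a cycle too. That must be the unique cycle
    \<open>E\<close>, of which a chord is not an edge.\<close>
  have chord: "{f i, f j} \<in> E" if "adj (f i) (f j)" for i j
  proof (rule ccontr)
    assume *: "{f i, f j} \<notin> E"
    let ?R = "parcs G - {(f i, f j), (f j, f i)}"
    have "(f k, f (Suc k)) \<in> ?R" for k
    proof -
      have "{f k, f (Suc k)} \<in> E" unfolding E' by blast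
      then have "(f k, f (Suc k)) \<noteq> (f i, f j)" "(f k, f (Suc k)) \<noteq> (f j, f i)"
        using * by (auto simp: insert_commute)
      then show ?thesis using arc[of k] by blast
    qed
    moreover have "0 < g" using p(2) unfolding g_def by linarith
    ultimately have "(f i, f j) \<in> ?R\<^sup>*"
      using period by (rule rtrancl_along_periodic)
    then show False using edge_on_cycle[OF that] E * by simp
  qed
  have "cycle_graph adj g f"
  proof (intro cycle_graph.intro adjacency cycle_graph_axioms.intro)
    show "3 \<le> g" using p(2) by (simp add: g_def)
    show "f i = f j \<longleftrightarrow> i mod g = j mod g" for i j by (rule eq)
    show "adj (f i) (f j) \<longleftrightarrow> j mod g = Suc i mod g \<or> i mod g = Suc j mod g" for i j
    proof
      assume "adj (f i) (f j)"
      then obtain k where "{f i, f j} = {f k, f (Suc k)}" using chord unfolding E' by blast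
      then show "j mod g = Suc i mod g \<or> i mod g = Suc j mod g"
        unfolding doubleton_eq_iff eq using Suc_eq[of i k] Suc_eq[of j k] by auto
    next
      assume "j mod g = Suc i mod g \<or> i mod g = Suc j mod g"
      then have "f j = f (Suc i) \<or> f i = f (Suc j)" by (simp add: eq)
      then show "adj (f i) (f j)" using arc[of i] arcs_symmetric[OF arc[of j]] by auto
    qed
  qed
  then show thesis using that E unfolding E' by blast
qed

text \<open>The restriction to \<open>S \<times> S\<close> guarantees that the connection avoids
  every vertex outside \<open>S\<close>, in particular one about to be attached.\<close>

lemma grown_connected:
  assumes "cycle_graph adj g f" "grown adj (range f) S" "a \<in> S" "b \<in> S"
  shows "(a, b) \<in> (parcs G \<inter> S \<times> S)\<^sup>*"
proof -
  interpret cg: cycle_graph adj g f by fact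
  show ?thesis
    using assms(2-)
  proof (induction arbitrary: a b rule: grown.induct)
    case base
    have "(f i, f (Suc i)) \<in> parcs G \<inter> range f \<times> range f" for i
      using cg.adj_f_iff[of i "Suc i"] by simp
    moreover have "0 < g" using cg.g_ge_3 by simp
    moreover have "f (i + k * g) = f i" for i k by (simp add: cg.f_eq_iff)
    ultimately have "(f i, f j) \<in> (parcs G \<inter> range f \<times> range f)\<^sup>*" for i j
      by (rule rtrancl_along_periodic)
    then show ?case using base by blast
  next
    case (attach S v p)
    let ?R = "parcs G \<inter> insert v S \<times> insert v S"
    have p: "p \<in> S" "(v, p) \<in> ?R" "(p, v) \<in> ?R"
    proof -
      have "p \<in> nbrs adj S v" using attach.hyps(3) by simp
      then show "p \<in> S" "(v, p) \<in> ?R" "(p, v) \<in> ?R"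
        using arcs_symmetric[of v p] by (auto simp: nbrs_def)
    qed
    have S: "(c, d) \<in> ?R\<^sup>*" if "c \<in> S" "d \<in> S" for c d
      using attach.IH[OF that] by (rule rtrancl_mono[THEN subsetD, rotated]) auto
    have "(v, d) \<in> ?R\<^sup>*" if "d \<in> insert v S" for d
      using that S[OF p(1), of d] p(2) by (auto intro: converse_rtrancl_into_rtrancl)
    moreover have "(c, v) \<in> ?R\<^sup>*" if "c \<in> insert v S" for c
      using that S[OF _ p(1), of c] p(3) by (auto intro: rtrancl_into_rtrancl)
    ultimately show ?case using attach.prems S by auto
  qed
qed

text \<open>Connectedness gives an edge from \<open>S\<close> to an outside vertex \<open>v\<close>.
  With a second neighbor of \<open>v\<close> in \<open>S\<close>, that edge could be bypassed
  through \<open>S\<close>, hence would lie on the unique cycle and put \<open>v\<close> into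
  \<open>S\<close>.\<close>

lemma obtain_attachable:
  assumes cg: "cycle_graph adj g f" and cs: "cycle_subgraphs G = {range (\<lambda>i. {f i, f (Suc i)})}"
    and S: "grown adj (range f) S" "S \<subset> pverts G"
  obtains v p where "v \<in> pverts G - S" "nbrs adj S v = {p}"
proof -
  interpret cg: cycle_graph adj g f by fact
  have "f 0 \<in> S" using cg.grown_superset[OF S(1)] by auto
  obtain b where b: "b \<in> pverts G" "b \<notin> S" using S(2) by auto
  have "strongly_connected G"
    using symmetric_connected_imp_strongly_connected[OF sym_arcs conn] .
  then have "(f 0, b) \<in> (parcs G)\<^sup>*"
    using \<open>f 0 \<in> S\<close> b S(2) unfolding strongly_connected_def reachable_def
    by (auto dest: rtrancl_on_rtranclI)
  then have "\<exists>s v. s \<in> S \<and> v \<notin> S \<and> adj s v"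
    using b(2) \<open>f 0 \<in> S\<close> by (induction rule: rtrancl_induct) auto
  then obtain s v where sv: "s \<in> S" "v \<notin> S" "adj v s" "v \<in> pverts G"
    using arcs_symmetric in_arcsD2 by blast
  have "s' = s" if "s' \<in> S" "adj v s'" for s'
  proof (rule ccontr)
    assume "s' \<noteq> s"
    let ?R = "parcs G - {(v, s), (s, v)}"
    have "(v, s') \<in> ?R" using that \<open>s' \<noteq> s\<close> sv by auto
    moreover have "(s', s) \<in> ?R\<^sup>*"
      using grown_connected[OF cg S(1) that(1) sv(1)] sv(2)
      by (rule_tac rtrancl_mono[THEN subsetD]) auto
    ultimately have "(v, s) \<in> ?R\<^sup>*" by (rule converse_rtrancl_into_rtrancl)
    then obtain i where "{v, s} = {f i, f (Suc i)}" using edge_on_cycle[OF sv(3)] cs by auto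
    then have "v \<in> range f" by (auto simp: doubleton_eq_iff)
    then show False using cg.grown_superset[OF S(1)] sv(2) by auto
  qed
  then have "nbrs adj S v \<subseteq> {s}" unfolding nbrs_def by blast
  moreover have "s \<in> nbrs adj S v" using sv(1,3) by (simp add: nbrs_def)
  ultimately have "nbrs adj S v = {s}" by blast
  with sv(2,4) show thesis by (intro that[of v s]) simp_all
qed

lemma grown_pverts:
  assumes cg: "cycle_graph adj g f" and cs: "cycle_subgraphs G = {range (\<lambda>i. {f i, f (Suc i)})}"
  shows "grown adj (range f) (pverts G)"
proof -
  have "grown adj (range f) (pverts G)" if "grown adj (range f) S" "S \<subseteq> pverts G" for S
    using that
  proof (induction "card (pverts G - S)" arbitrary: S rule: less_induct)
    case less
    show ?case
    proof (cases "S = pverts G")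
      case True
      then show ?thesis using less by simp
    next
      case False
      then obtain v p where v: "v \<in> pverts G - S" "nbrs adj S v = {p}"
        using obtain_attachable[OF cg cs less.prems(1)] less.prems(2) by blast
      then have "grown adj (range f) (insert v S)" using less.prems(1) by (auto intro: grown.attach)
      moreover have "pverts G - insert v S \<subset> pverts G - S" using v by auto
      then have "card (pverts G - insert v S) < card (pverts G - S)"
        using pair_finite_verts by (intro psubset_card_mono) auto
      ultimately show ?thesis using less.hyps[of "insert v S"] less.prems(2) v by auto
    qed
  qed
  moreover have "f i \<in> pverts G" for i
    using cycle_graph.adj_f_iff[OF cg, of i "Suc i"] in_arcsD1 by simp
  then have "range f \<subseteq> pverts G" by blast
  ultimately show ?thesis using grown.base by blast
qed

lemma cycle_verts_eq:
  assumes "cycle_subgraphs G = {range (\<lambda>i. {f i, f (Suc i)})}"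
  shows "cycle_verts G = range f"
  using assms by (auto simp: cycle_verts_def)

end

section \<open>Cuttlefish\<close>

lemma (in pair_fin_digraph) out_degree_eq_card_nbrs:
  "out_degree (with_proj G) v = card (nbrs adj (pverts G) v)"
proof -
  have "out_arcs (with_proj G) v = Pair v ` nbrs adj (pverts G) v"
    using in_arcsD2 by (auto simp: out_arcs_def nbrs_def)
  then show ?thesis by (simp add: out_degree_def card_image inj_on_def)
qed

context connected_unicyclic_graph
begin

text \<open>The second alternative yields a tentacle of length at least 2, which a cuttlefish
  excludes. Along the growth, the first vertex attached to a vertex off the cycle creates such a
  path. When a vertex is attached to the end of the path, the path is prolonged; other attachments
  leave it intact.\<close>

lemma grown_leaf_path:
  assumes cg: "cycle_graph adj g f" and S: "grown adj (range f) S" "S \<subseteq> pverts G"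
  shows "(\<forall>v\<in>S - range f. \<exists>w\<in>range f. adj v w) \<or>
    (\<exists>u p v. u \<in> range f \<and> apath u p v \<and> 2 \<le> length p \<and> set (awalk_verts u p) \<subseteq> S \<and>
      set (tl (awalk_verts u p)) \<inter> range f = {} \<and> card (nbrs adj S v) = 1)"
  using S
proof (induction rule: grown.induct)
  case base
  then show ?case by simp
next
  case (attach S v p)
  interpret cg: cycle_graph adj g f by fact
  have vW: "v \<notin> range f" using cg.grown_superset[OF attach(1)] attach(2) by auto
  have "p \<in> nbrs adj S v" using attach(3) by simp
  then have p: "p \<in> S" "adj v p" "p \<noteq> v" "adj p v"
    using attach(2) arcs_symmetric[of v p] by (auto simp: nbrs_def)
  have v: "v \<in> pverts G" "S \<subseteq> pverts G" using attach.prems by auto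
  note cn = cg.card_nbrs_attach[OF cg.grown_finite[OF attach(1)] attach(2,3)]
  from attach.IH[OF v(2)] show ?case
  proof
    assume all: "\<forall>v\<in>S - range f. \<exists>w\<in>range f. adj v w"
    show ?thesis
    proof (cases "p \<in> range f")
      case True
      then have "\<forall>x\<in>insert v S - range f. \<exists>w\<in>range f. adj x w" using all p(2) by blast
      then show ?thesis by (rule disjI1)
    next
      case False
      then obtain w where w: "w \<in> range f" "adj p w" using all p(1) by blast
      have wS: "w \<in> S" using w cg.grown_superset[OF attach(1)] by auto
      have "w \<noteq> p" "w \<noteq> v" using False w(1) vW by auto
      then have "apath w [(w, p), (p, v)] v"
        using p v wS arcs_symmetric[OF w(2)] by (auto simp: apath_def awalk_def)
      moreover have "set (awalk_verts w [(w, p), (p, v)]) \<subseteq> insert v S"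
        using wS p(1) by simp
      moreover have "set (tl (awalk_verts w [(w, p), (p, v)])) \<inter> range f = {}"
        using False vW by simp
      moreover have "card (nbrs adj (insert v S) v) = 1" using cn[of v] by simp
      ultimately have "w \<in> range f \<and> apath w [(w, p), (p, v)] v \<and> 2 \<le> length [(w, p), (p, v)] \<and>
          set (awalk_verts w [(w, p), (p, v)]) \<subseteq> insert v S \<and>
          set (tl (awalk_verts w [(w, p), (p, v)])) \<inter> range f = {} \<and>
          card (nbrs adj (insert v S) v) = 1"
        using w(1) by simp
      then show ?thesis by (intro disjI2 exI)
    qed
  next
    assume "\<exists>u q x. u \<in> range f \<and> apath u q x \<and> 2 \<le> length q \<and> set (awalk_verts u q) \<subseteq> S \<and>
      set (tl (awalk_verts u q)) \<inter> range f = {} \<and> card (nbrs adj S x) = 1"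
    then obtain u q x where q: "u \<in> range f" "apath u q x" "2 \<le> length q"
      "set (awalk_verts u q) \<subseteq> S" "set (tl (awalk_verts u q)) \<inter> range f = {}"
      "card (nbrs adj S x) = 1" by blast
    have aw: "awalk u q x" and dist: "distinct (awalk_verts u q)" using q(2) by (auto simp: apath_def)
    have "last (awalk_verts u q) = x" using aw by (rule awalkE')
    then have "x \<in> set (awalk_verts u q)" using last_in_set[OF awalk_verts_non_Nil, of u q] by simp
    then have x: "x \<in> S" "x \<noteq> v" using q(4) attach(2) by auto
    show ?thesis
    proof (cases "x = p")
      case False
      then have "card (nbrs adj (insert v S) x) = 1" using cn[of x] x q(6) by simp
      moreover have "set (awalk_verts u q) \<subseteq> insert v S" using q(4) by blast
      ultimately show ?thesis using q(1-3,5) by (intro disjI2 exI conjI)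
    next
      case True
      let ?q = "q @ [(x, v)]"
      have "awalk x [(x, v)] v" using True p v by (auto simp: awalk_def)
      then have aw': "awalk u ?q v" by (rule awalk_appendI[OF aw])
      have verts: "awalk_verts u ?q = awalk_verts u q @ [v]"
        using awalk_verts_append[OF aw'] by simp
      obtain ws where ws: "awalk_verts u q = u # ws"
        using awhd_of_awalk[OF aw] by (cases "awalk_verts u q") auto
      have "v \<notin> set (awalk_verts u q)" using q(4) attach(2) by auto
      then have "apath u ?q v" using aw' dist by (simp add: apath_def verts)
      moreover have "2 \<le> length ?q" using q(3) by simp
      moreover have "set (awalk_verts u ?q) \<subseteq> insert v S" using q(4) by (auto simp: verts)
      moreover have "set (tl (awalk_verts u ?q)) \<inter> range f = {}"
        using q(5) vW by (simp add: verts ws)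
      moreover have "card (nbrs adj (insert v S) v) = 1" using cn[of v] by simp
      ultimately show ?thesis using q(1) by (intro disjI2 exI conjI)
    qed
  qed
qed

text \<open>The only vertex \<open>h\<close> of degree greater than 2 lies on the cycle, as some
  cycle vertex has positive excess. Without long tentacles every vertex off the cycle has a neighbor
  on the cycle, and this can only be \<open>h\<close>.\<close>

lemma cuttlefish_hub:
  assumes "cuttlefish G" and cg: "cycle_graph adj g f"
    and cs: "cycle_subgraphs G = {range (\<lambda>i. {f i, f (Suc i)})}"
  shows "g < card (pverts G)"
    and "\<exists>v\<in>range f. card (pverts G) - g \<le> cycle_graph.excess adj f (pverts G) v"
proof -
  interpret cg: cycle_graph adj g f by fact
  let ?V = "pverts G"
  let ?deg = "\<lambda>v. card (nbrs adj ?V v)"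
  have V: "grown adj (range f) ?V" by (rule grown_pverts[OF cg cs])
  have WV: "range f \<subseteq> ?V" by (rule cg.grown_superset[OF V])
  have fin: "finite ?V" by (rule pair_finite_verts)
  obtain h where h: "h \<in> ?V" "2 < ?deg h" and uniq: "\<And>v. v \<in> ?V \<Longrightarrow> 2 < ?deg v \<Longrightarrow> v = h"
    using assms(1) unfolding cuttlefish_def squid_def out_degree_eq_card_nbrs by blast
  have tent: "length p = 1" if "tentacle G p" for p
    using assms(1) that unfolding cuttlefish_def by blast
  have "range f \<noteq> ?V"
  proof
    assume "range f = ?V"
    then show False using cg.card_nbrs_cycle[of h] h by simp
  qed
  then have "range f \<subset> ?V" using WV by blast
  then show "g < card ?V" using psubset_card_mono[OF fin, of "range f"] cg.card_W by simp
  obtain w where w: "w \<in> range f" "0 < cg.excess ?V w"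
    using cg.grown_excess_on_cycle[OF V] \<open>range f \<noteq> ?V\<close> by blast
  have "w \<in> ?V" using w(1) WV by blast
  moreover have "2 < ?deg w" using w unfolding cg.excess_def by simp
  ultimately have "w = h" by (rule uniq)
  then have hW: "h \<in> range f" using w by simp
  have "\<forall>v\<in>?V - range f. \<exists>w\<in>range f. adj v w"
  proof (rule ccontr)
    assume "\<not> ?thesis"
    then obtain u p v where p: "u \<in> range f" "apath u p v" "2 \<le> length p"
      "set (tl (awalk_verts u p)) \<inter> range f = {}" "?deg v = 1"
      using grown_leaf_path[OF cg V subset_refl] by blast
    have "p \<noteq> []" using p(3) by auto
    then have "tentacle G p"
      unfolding tentacle_def cycle_verts_eq[OF cs] out_degree_eq_card_nbrs awalk_verts_with_proj_eq
      using p by blast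
    then show False using tent p(3) by fastforce
  qed
  \<comment> \<open>Together with its two neighbors on the cycle, \<open>x\<close> would give
    \<open>w\<close> degree at least 3.\<close>
  moreover have "w = h" if x: "x \<in> ?V - range f" and "w \<in> range f" "adj x w" for x w
  proof (rule ccontr)
    assume "w \<noteq> h"
    have "w \<in> ?V" using WV that by auto
    have "insert x (nbrs adj (range f) w) \<subseteq> nbrs adj ?V w"
      using WV x arcs_symmetric[OF \<open>adj x w\<close>] by (auto simp: nbrs_def)
    then have "card (insert x (nbrs adj (range f) w)) \<le> ?deg w"
      using fin by (intro card_mono) auto
    moreover have "x \<notin> nbrs adj (range f) w" using x by (auto simp: nbrs_def)
    ultimately have "2 < ?deg w"
      using cg.card_nbrs_cycle[OF \<open>w \<in> range f\<close>] cg.finite_W by simp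
    then show False using uniq[OF \<open>w \<in> ?V\<close>] \<open>w \<noteq> h\<close> by simp
  qed
  ultimately have leaf: "adj h x" if "x \<in> ?V - range f" for x
    using that arcs_symmetric by blast
  have "nbrs adj (range f) h \<union> (?V - range f) \<subseteq> nbrs adj ?V h"
    using leaf WV by (auto simp: nbrs_def)
  then have "card (nbrs adj (range f) h \<union> (?V - range f)) \<le> ?deg h"
    using fin by (intro card_mono) auto
  moreover have "card (nbrs adj (range f) h \<union> (?V - range f)) = 2 + (card ?V - g)"
    using cg.card_nbrs_cycle[OF hW] fin WV cg.finite_W cg.card_W
    by (subst card_Un_disjoint) (auto simp: nbrs_def card_Diff_subset)
  ultimately have "card ?V - g \<le> cg.excess ?V h" using hW unfolding cg.excess_def by simp
  then show "\<exists>v\<in>range f. card ?V - g \<le> cg.excess ?V v" using hW by (intro bexI)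
qed

end

section \<open>Graphs with concentrated excess are isomorphic\<close>

text \<open>The cycles are matched along parametrizations starting at the hubs. The leaves may be
  matched arbitrarily, since by \<open>adj_concentrated\<close> each of them is adjacent to the hub
  and to nothing else.\<close>

lemma bij_betw_of_concentrated:
  assumes "cycle_graph adj g f" and S: "grown adj (range f) S"
    and v: "v \<in> range f" "card S - g \<le> cycle_graph.excess adj f S v"
    and "cycle_graph adj' g f'" and S': "grown adj' (range f') S'"
    and v': "v' \<in> range f'" "card S' - g \<le> cycle_graph.excess adj' f' S' v'"
    and card_eq: "card S = card S'"
  shows "\<exists>\<phi>. bij_betw \<phi> S S' \<and> (\<forall>a\<in>S. \<forall>b\<in>S. adj a b \<longleftrightarrow> adj' (\<phi> a) (\<phi> b))"
proof -
  interpret a: cycle_graph adj g f by fact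
  interpret b: cycle_graph adj' g f' by fact
  obtain i i' where i: "v = f i" "v' = f' i'" using v v' by auto
  define F F' where "F j = f (j + i)" and "F' j = f' (j + i')" for j
  interpret A: cycle_graph adj g F unfolding F_def by (rule a.shift)
  interpret B: cycle_graph adj' g F' unfolding F'_def by (rule b.shift)
  have W: "range F = range f" "range F' = range f'"
    unfolding F_def F'_def by (rule a.range_shift b.range_shift)+
  have hub: "v = F 0" "v' = F' 0" by (simp_all add: F_def F'_def i)
  have sub: "range f \<subseteq> S" "range f' \<subseteq> S'" and fin: "finite S" "finite S'"
    using a.grown_superset[OF S] b.grown_superset[OF S'] a.grown_finite[OF S] b.grown_finite[OF S']
    by auto
  have "card (S - range f) = card (S' - range f')"
    using sub a.finite_W b.finite_W a.card_W b.card_W card_eq by (simp add: card_Diff_subset)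
  then obtain \<psi> where \<psi>: "bij_betw \<psi> (S - range f) (S' - range f')"
    using finite_same_card_bij fin by blast
  \<comment> \<open>The chosen index is determined modulo \<open>g\<close> only, which is enough
    because \<open>F'\<close> has the same period.\<close>
  define \<phi> where "\<phi> x = (if x \<in> range F then F' (SOME j. F j = x) else \<psi> x)" for x
  have \<phi>F: "\<phi> (F j) = F' j" for j
  proof -
    have "F (SOME k. F k = F j) = F j" by (rule someI) simp
    then have "F' (SOME k. F k = F j) = F' j" unfolding A.f_eq_iff B.f_eq_iff .
    then show ?thesis by (simp add: \<phi>_def)
  qed
  have "bij_betw \<phi> (range F) (range F')"
  proof (intro bij_betw_imageI)
    show "inj_on \<phi> (range F)"
    proof (rule inj_onI)
      fix x y assume "x \<in> range F" "y \<in> range F" "\<phi> x = \<phi> y"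
      then obtain j k where "x = F j" "y = F k" "F' j = F' k" using \<phi>F by auto
      then show "x = y" by (simp add: A.f_eq_iff B.f_eq_iff)
    qed
    show "\<phi> ` range F = range F'" by (simp add: image_image \<phi>F)
  qed
  moreover have "bij_betw \<phi> (S - range F) (S' - range F')"
    using \<psi> unfolding W by (subst bij_betw_cong[of _ _ \<psi>]) (auto simp: \<phi>_def W)
  ultimately have "bij_betw \<phi> (range F \<union> (S - range F)) (range F' \<union> (S' - range F'))"
    by (rule bij_betw_combine) auto
  then have bij: "bij_betw \<phi> S S'" using sub by (simp add: W Un_absorb1)
  have mem: "\<phi> x \<in> range f' \<longleftrightarrow> x \<in> range f" if "x \<in> S" for x
  proof (cases "x \<in> range f")
    case True
    then obtain j where "x = F j" unfolding W[symmetric] by blast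
    then show ?thesis using True by (simp add: \<phi>F W(2)[symmetric])
  next
    case False
    then have "\<phi> x = \<psi> x" by (simp add: \<phi>_def W)
    then show ?thesis using False that bij_betwE[OF \<psi>] by auto
  qed
  have "v \<in> S" "v' \<in> S'" using v v' sub by auto
  have eqv: "\<phi> x = v' \<longleftrightarrow> x = v" if "x \<in> S" for x
    using bij_betw_imp_inj_on[OF bij] that \<open>v \<in> S\<close> \<phi>F[of 0] hub by (metis inj_onD)
  have "adj x y \<longleftrightarrow> adj' (\<phi> x) (\<phi> y)" if "x \<in> S" "y \<in> S" for x y
  proof -
    have "\<phi> x \<in> S'" "\<phi> y \<in> S'" using bij that by (auto dest: bij_betwE)
    \<comment> \<open>Within the cycle the indices decide adjacency. Otherwise an edge joins the hub
      to a leaf, and \<open>\<phi>\<close> preserves both being the hub and lying on the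
      cycle.\<close>
    show ?thesis
    proof (cases "x \<in> range f \<and> y \<in> range f")
      case True
      then obtain j k where "x = F j" "y = F k" unfolding W[symmetric] by blast
      then show ?thesis by (simp add: \<phi>F A.adj_f_iff B.adj_f_iff)
    next
      case False
      then have "adj x y \<longleftrightarrow> x = v \<and> y \<notin> range f \<or> y = v \<and> x \<notin> range f"
        using a.adj_concentrated[OF S v that] by blast
      moreover have "\<not> (\<phi> x \<in> range f' \<and> \<phi> y \<in> range f')"
        unfolding mem[OF that(1)] mem[OF that(2)] by (rule False)
      then have "adj' (\<phi> x) (\<phi> y) \<longleftrightarrow>
          \<phi> x = v' \<and> \<phi> y \<notin> range f' \<or> \<phi> y = v' \<and> \<phi> x \<notin> range f'"
        using b.adj_concentrated[OF S' v' \<open>\<phi> x \<in> S'\<close> \<open>\<phi> y \<in> S'\<close>] by blast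
      ultimately show ?thesis
        unfolding mem[OF that(1)] mem[OF that(2)] eqv[OF that(1)] eqv[OF that(2)] by simp
    qed
  qed
  then show ?thesis using bij by blast
qed

text \<open>Arcs are pairs of vertices, so a vertex bijection \<open>\<phi>\<close> induces the arc
  map \<open>map_prod \<phi> \<phi>\<close>, and the remaining fields of the isomorphism record are
  the projections.\<close>

lemma digraph_isoI:
  assumes "pair_wf_digraph G" "pair_wf_digraph H" and bij: "bij_betw \<phi> (pverts G) (pverts H)"
    and arcs: "\<And>a b. a \<in> pverts G \<Longrightarrow> b \<in> pverts G \<Longrightarrow> (a, b) \<in> parcs G \<longleftrightarrow> (\<phi> a, \<phi> b) \<in> parcs H"
  shows "digraph_iso (with_proj G) (with_proj H)"
proof -
  interpret G: pair_wf_digraph G by fact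
  interpret H: pair_wf_digraph H by fact
  define hom where "hom = \<lparr>iso_verts = \<phi>, iso_arcs = map_prod \<phi> \<phi>, iso_head = snd, iso_tail = fst\<rparr>"
  have inj: "inj_on \<phi> (pverts G)" and img: "\<phi> ` pverts G = pverts H"
    using bij by (auto simp: bij_betw_def)
  have sub: "parcs G \<subseteq> pverts G \<times> pverts G" by (auto dest: G.in_arcsD1 G.in_arcsD2)
  have "inj_on (map_prod \<phi> \<phi>) (parcs G)"
    by (rule inj_on_subset[OF map_prod_inj_on[OF inj inj] sub])
  then have "G.digraph_isomorphism hom"
    unfolding G.digraph_isomorphism_def using inj G.wf_digraph_axioms by (auto simp: hom_def)
  moreover have "parcs H = map_prod \<phi> \<phi> ` parcs G"
  proof (intro equalityI subsetI)
    fix e assume "e \<in> parcs H"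
    moreover obtain c d where e: "e = (c, d)" by (cases e)
    ultimately have "c \<in> \<phi> ` pverts G" "d \<in> \<phi> ` pverts G"
      using H.in_arcsD1 H.in_arcsD2 img by auto
    then obtain a b where "a \<in> pverts G" "b \<in> pverts G" "c = \<phi> a" "d = \<phi> b" by blast
    then show "e \<in> map_prod \<phi> \<phi> ` parcs G"
      using arcs[of a b] \<open>e \<in> parcs H\<close> e by (intro image_eqI[of _ _ "(a, b)"]) auto
  next
    fix e assume "e \<in> map_prod \<phi> \<phi> ` parcs G"
    then show "e \<in> parcs H" using arcs sub by auto
  qed
  then have "with_proj H = app_iso hom (with_proj G)"
    by (simp add: app_iso_def hom_def with_proj_def img)
  ultimately show ?thesis unfolding digraph_iso_def by blast
qed

theorem proposition5p18:
  fixes C :: "'a pair_pre_digraph" and G :: "'b pair_pre_digraph" and n :: nat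
  assumes "pair_graph C" and "cuttlefish C" and "card (pverts C) = n"
    and "pair_graph G" and "Digraph_Component.connected (with_proj G)" and "unicyclic G"
    and "card (pverts G) = n"
    and "chromatic_symmetric_function G = chromatic_symmetric_function C"
  shows "digraph_iso (with_proj G) (with_proj C)"
proof -
  interpret C: connected_unicyclic_graph C
    using assms(1,2) by (simp add: connected_unicyclic_graph_def connected_unicyclic_graph_axioms_def
        cuttlefish_def squid_def)
  interpret G: connected_unicyclic_graph G
    using assms(4-6) by (simp add: connected_unicyclic_graph_def connected_unicyclic_graph_axioms_def)
  obtain c f' where C: "cycle_graph C.adj c f'" "cycle_subgraphs C = {range (\<lambda>i. {f' i, f' (Suc i)})}"
    by (rule C.obtain_cycle_graph)
  obtain g f where G: "cycle_graph G.adj g f" "cycle_subgraphs G = {range (\<lambda>i. {f i, f (Suc i)})}"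
    by (rule G.obtain_cycle_graph)
  note grown = G.grown_pverts[OF G] C.grown_pverts[OF C]
  note fin = G.pair_finite_verts C.pair_finite_verts
  have card_eq: "card (pverts G) = card (pverts C)" using assms by simp
  obtain h where h: "h \<in> range f'"
    "card (pverts C) - c \<le> cycle_graph.excess C.adj f' (pverts C) h"
    using C.cuttlefish_hub(2)[OF assms(2) C] by blast
  \<comment> \<open>Three colors serve to find the cycle length, two colors after deleting a vertex
    to locate the excess.\<close>
  note three = card_colorings_eq_of_csf_eq[OF G.pair_wf_digraph_axioms fin(1)
      C.pair_wf_digraph_axioms fin(2) assms(8), of 3]
  note deleted = sum_card_colorings_delete_eq_of_csf_eq[OF G.pair_loopfree_digraph_axioms fin(1)
      C.pair_loopfree_digraph_axioms fin(2) assms(8), of 2]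
  note concentrated = concentrated_excess_of_equal_counts[OF G(1) grown(1) C(1) grown(2) card_eq
      three deleted h C.cuttlefish_hub(1)[OF assms(2) C]]
  obtain v where v: "v \<in> range f"
    "card (pverts G) - g \<le> cycle_graph.excess G.adj f (pverts G) v"
    using concentrated(2) by blast
  \<comment> \<open>Folding with \<open>g = c\<close> gives both cycles the same period, as matching
    them requires.\<close>
  obtain \<phi> where "bij_betw \<phi> (pverts G) (pverts C)"
    "\<forall>a\<in>pverts G. \<forall>b\<in>pverts G. G.adj a b \<longleftrightarrow> C.adj (\<phi> a) (\<phi> b)"
    using bij_betw_of_concentrated[OF G(1) grown(1) v C(1)[folded concentrated(1)] grown(2)
        h[folded concentrated(1)] card_eq] by blast
  then show ?thesis
    by (intro digraph_isoI[OF G.pair_wf_digraph_axioms C.pair_wf_digraph_axioms]) auto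
qed

end
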